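(* Let $\mathcal{E}$ be a symmetric sequence space, and suppose $0 \leq \mathbf{S}_\phi \leq \mathbf{S}_\psi$ are Schur multipliers from $\mathcal{S}_1$ to $\mathcal{S}_{\mathcal{E}}$. If $\mathbf{S}_\psi$ is Dunford-Pettis, then the same is true for $\mathbf{S}_\phi$.
   Context: A symmetric sequence space $\mathcal{E}$ (on $\mathbb{N}$) is a Banach space of scalar sequences such that, if $x\in\mathcal{E}$ and the non-increasing rearrangement of $|y|$ is dominated pointwise by that of $|x|$, then $y\in\mathcal{E}$ and $\|y\|\le\|x\|$. The Schatten space $\mathcal{S}_{\mathcal{E}}$ consists of those $x\in B(\ell_2)$ whose sequence of singular numbers belongs to $\mathcal{E}$, normed by the $\mathcal{E}$-norm of that sequence and ordered by its cone of positive operators; $\mathcal{S}_1$ is the space for $\mathcal{E}=\ell_1$ (trace class operators on $\ell_2$). A bounded linear map $T:\mathcal{S}_1\to\mathcal{S}_{\mathcal{E}}$ is a Schur multiplier with symbol the infinite matrix $\phi=(\phi_{ij})$, denoted $\mathbf{S}_\phi$, if in matrix coordinates with respect to the canonical basis of $\ell_2$, $(Tx)_{ij}=\phi_{ij}x_{ij}$ for all $i,j$. $T\ge0$ means that $T$ maps positive elements to positive elements; $T\le S$ means $S-T\ge0$. An operator is Dunford-Pettis if it maps weakly null sequences to norm null ones. *)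

theory Defs
  imports "HOL-Analysis.Analysis"
begin

section \<open>The complex Hilbert space \<open>\<ell>\<^sub>2\<close>\<close>

typedef ell2 = "{x :: nat \<Rightarrow> complex. summable (\<lambda>n. (cmod (x n))\<^sup>2)}"
  morphisms coord Abs_ell2
  by (rule exI[of _ "\<lambda>_. 0"]) simp

setup_lifting type_definition_ell2

lemma coord_summable: "summable (\<lambda>n. (cmod (coord x n))\<^sup>2)"
  using coord[of x] by simp

lemma coord_eqI: "(\<And>n. coord x n = coord y n) \<Longrightarrow> x = y"
  by (metis coord_inject ext)

lemma summable_sq_add:
  fixes x y :: "nat \<Rightarrow> complex"
  assumes "summable (\<lambda>n. (cmod (x n))\<^sup>2)" "summable (\<lambda>n. (cmod (y n))\<^sup>2)"
  shows "summable (\<lambda>n. (cmod (x n + y n))\<^sup>2)"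
proof (rule summable_comparison_test_ev)
  show "summable (\<lambda>n. 2 * (cmod (x n))\<^sup>2 + 2 * (cmod (y n))\<^sup>2)"
    using assms by (intro summable_add summable_mult)
  have "(cmod (x n + y n))\<^sup>2 \<le> 2 * (cmod (x n))\<^sup>2 + 2 * (cmod (y n))\<^sup>2" for n
  proof -
    have "(cmod (x n + y n))\<^sup>2 \<le> (cmod (x n) + cmod (y n))\<^sup>2"
      by (intro power_mono norm_triangle_ineq) auto
    also have "\<dots> \<le> 2 * (cmod (x n))\<^sup>2 + 2 * (cmod (y n))\<^sup>2"
      using sum_squares_bound[of "cmod (x n)" "cmod (y n)"]
      by (simp add: power2_eq_square algebra_simps)
    finally show ?thesis .
  qed
  then show "\<forall>\<^sub>F n in sequentially. norm ((cmod (x n + y n))\<^sup>2)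
      \<le> 2 * (cmod (x n))\<^sup>2 + 2 * (cmod (y n))\<^sup>2"
    by simp
qed

lemma summable_sq_cmult:
  fixes x :: "nat \<Rightarrow> complex"
  assumes "summable (\<lambda>n. (cmod (x n))\<^sup>2)"
  shows "summable (\<lambda>n. (cmod (c * x n))\<^sup>2)"
  using summable_mult[OF assms, of "(cmod c)\<^sup>2"] by (simp add: norm_mult power_mult_distrib)

lift_definition scaleC_ell2 :: "complex \<Rightarrow> ell2 \<Rightarrow> ell2" (infixr \<open>*\<^sub>C\<close> 75)
  is "\<lambda>c x n. c * x n"
  by (rule summable_sq_cmult)

lift_definition cinner :: "ell2 \<Rightarrow> ell2 \<Rightarrow> complex"
  is "\<lambda>x y. \<Sum>n. x n * cnj (y n)" .

lift_definition unit_vec :: "nat \<Rightarrow> ell2"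
  is "\<lambda>k n. if n = k then 1 else 0"
proof -
  fix k :: nat
  have "(\<lambda>n. (cmod (if n = k then 1 else 0))\<^sup>2) = (\<lambda>n. if n = k then 1 else 0)"
    by auto
  then show "summable (\<lambda>n. (cmod (if n = k then 1 else 0))\<^sup>2)"
    using summable_single[of k "\<lambda>_. 1 :: real"] by simp
qed

lemma cinner_summable: "summable (\<lambda>n. coord x n * cnj (coord y n))"
proof (rule summable_norm_cancel, rule summable_comparison_test_ev)
  show "summable (\<lambda>n. (cmod (coord x n))\<^sup>2 + (cmod (coord y n))\<^sup>2)"
    by (intro summable_add coord_summable)
  have "cmod (coord x n) * cmod (coord y n) \<le> (cmod (coord x n))\<^sup>2 + (cmod (coord y n))\<^sup>2" for n
  proof -
    have "0 \<le> cmod (coord x n) * cmod (coord y n)"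
      by simp
    then show ?thesis
      using sum_squares_bound[of "cmod (coord x n)" "cmod (coord y n)"] by linarith
  qed
  then show "\<forall>\<^sub>F n in sequentially. norm (norm (coord x n * cnj (coord y n)))
      \<le> (cmod (coord x n))\<^sup>2 + (cmod (coord y n))\<^sup>2"
    by (simp add: norm_mult)
qed

instantiation ell2 :: real_vector
begin

lift_definition zero_ell2 :: ell2 is "\<lambda>_. 0" by simp
lift_definition plus_ell2 :: "ell2 \<Rightarrow> ell2 \<Rightarrow> ell2" is "\<lambda>x y n. x n + y n"
  by (rule summable_sq_add)
lift_definition uminus_ell2 :: "ell2 \<Rightarrow> ell2" is "\<lambda>x n. - x n" by simp
lift_definition minus_ell2 :: "ell2 \<Rightarrow> ell2 \<Rightarrow> ell2" is "\<lambda>x y n. x n - y n"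
proof -
  fix x y :: "nat \<Rightarrow> complex"
  assume "summable (\<lambda>n. (cmod (x n))\<^sup>2)" "summable (\<lambda>n. (cmod (y n))\<^sup>2)"
  then show "summable (\<lambda>n. (cmod (x n - y n))\<^sup>2)"
    using summable_sq_add[of x "\<lambda>n. - y n"] by simp
qed
definition scaleR_ell2 :: "real \<Rightarrow> ell2 \<Rightarrow> ell2" where
  "scaleR_ell2 r x = complex_of_real r *\<^sub>C x"

instance
  by standard (unfold scaleR_ell2_def, (transfer, simp add: algebra_simps fun_eq_iff)+)

end

instantiation ell2 :: real_inner
begin

definition inner_ell2 :: "ell2 \<Rightarrow> ell2 \<Rightarrow> real" where
  "inner_ell2 x y = Re (cinner x y)"
definition norm_ell2 :: "ell2 \<Rightarrow> real" where
  "norm_ell2 x = sqrt (\<Sum>n. (cmod (coord x n))\<^sup>2)"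
definition dist_ell2 :: "ell2 \<Rightarrow> ell2 \<Rightarrow> real" where
  "dist_ell2 x y = norm (x - y)"
definition sgn_ell2 :: "ell2 \<Rightarrow> ell2" where
  "sgn_ell2 x = x /\<^sub>R norm x"
definition uniformity_ell2 :: "(ell2 \<times> ell2) filter" where
  "uniformity_ell2 = (INF e\<in>{0<..}. principal {(x, y). dist x y < e})"
definition open_ell2 :: "ell2 set \<Rightarrow> bool" where
  "open_ell2 U = (\<forall>x\<in>U. \<forall>\<^sub>F (x', y) in uniformity. x' = x \<longrightarrow> y \<in> U)"

instance
proof
  have inner_sum: "(\<lambda>n. Re (coord x n * cnj (coord y n))) sums inner x y" for x y :: ell2
    unfolding inner_ell2_def cinner.rep_eq
    by (intro sums_Re summable_sums cinner_summable)
  have self: "inner x x = (\<Sum>n. (cmod (coord x n))\<^sup>2)" for x :: ell2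
    using sums_unique[OF inner_sum[of x x]]
    by (simp add: complex_mult_cnj cmod_power2)
  fix x y z :: ell2 and r :: real
  show "dist x y = norm (x - y)" by (rule dist_ell2_def)
  show "sgn x = x /\<^sub>R norm x" by (rule sgn_ell2_def)
  show "uniformity = (INF e\<in>{0<..}. principal {(x, y :: ell2). dist x y < e})"
    by (rule uniformity_ell2_def)
  show "open U = (\<forall>x\<in>U. \<forall>\<^sub>F (x', y) in uniformity. x' = x \<longrightarrow> y \<in> U)" for U :: "ell2 set"
    by (rule open_ell2_def)
  show "inner x y = inner y x"
    using inner_sum[of x y] inner_sum[of y x]
    by (simp add: mult.commute sums_unique2)
  show "inner (x + y) z = inner x z + inner y z"
    using inner_sum[of "x + y" z] sums_add[OF inner_sum[of x z] inner_sum[of y z]]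
    by (intro sums_unique2[OF inner_sum]) (simp add: plus_ell2.rep_eq algebra_simps)
  show "inner (r *\<^sub>R x) y = r * inner x y"
    using sums_mult[OF inner_sum[of x y], of r]
    by (intro sums_unique2[OF inner_sum])
      (simp add: scaleR_ell2_def scaleC_ell2.rep_eq algebra_simps)
  show "0 \<le> inner x x"
    unfolding self by (intro suminf_nonneg coord_summable) simp
  show "inner x x = 0 \<longleftrightarrow> x = 0"
    unfolding self
    by (subst suminf_eq_zero_iff[OF coord_summable])
      (auto simp: zero_ell2.rep_eq intro: coord_eqI)
  show "norm x = sqrt (inner x x)"
    unfolding self norm_ell2_def ..
qed

end

interpretation ell2: vector_space scaleC_ell2
  by standard (transfer, simp add: algebra_simps fun_eq_iff)+

lemma norm_scaleC: "norm (c *\<^sub>C x) = cmod c * norm x"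
proof -
  have "(\<Sum>n. (cmod (c * coord x n))\<^sup>2) = (cmod c)\<^sup>2 * (\<Sum>n. (cmod (coord x n))\<^sup>2)"
    by (simp add: norm_mult power_mult_distrib suminf_mult coord_summable)
  then show ?thesis
    by (simp add: norm_ell2_def scaleC_ell2.rep_eq real_sqrt_mult)
qed

lemma bounded_linear_scaleC: "bounded_linear (\<lambda>x. c *\<^sub>C x)"
proof (rule bounded_linear_intro[where K = "cmod c"])
  show "c *\<^sub>C (x + y) = c *\<^sub>C x + c *\<^sub>C y" for x y
    by (rule ell2.scale_right_distrib)
  show "c *\<^sub>C (r *\<^sub>R x) = r *\<^sub>R (c *\<^sub>C x)" for r x
    by (simp add: scaleR_ell2_def mult.commute)
  show "norm (c *\<^sub>C x) \<le> norm x * cmod c" for x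
    by (simp add: norm_scaleC mult.commute)
qed


section \<open>Bounded operators on \<open>\<ell>\<^sub>2\<close>\<close>

text \<open>
  The type of bounded real-linear maps carries the algebraic operations and the operator norm;
  \<open>B(\<ell>\<^sub>2)\<close> is its subset of complex-linear maps.
\<close>

type_synonym oper = "ell2 \<Rightarrow>\<^sub>L ell2"

definition B_ell2 :: "oper set" where
  "B_ell2 = {x. Vector_Spaces.linear scaleC_ell2 scaleC_ell2 (blinfun_apply x)}"

definition scaleC_oper :: "complex \<Rightarrow> oper \<Rightarrow> oper" where
  "scaleC_oper c x = Blinfun (\<lambda>v. c *\<^sub>C x v)"

lemma scaleC_oper_apply: "scaleC_oper c x v = c *\<^sub>C x v"
  unfolding scaleC_oper_def
  by (subst bounded_linear_Blinfun_apply)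
    (auto intro: bounded_linear_compose[OF bounded_linear_scaleC] blinfun.bounded_linear_right)

definition entry :: "oper \<Rightarrow> nat \<Rightarrow> nat \<Rightarrow> complex" where
  "entry x i j = cinner (x (unit_vec j)) (unit_vec i)"

definition pos_oper :: "oper \<Rightarrow> bool" where
  "pos_oper x \<longleftrightarrow> x \<in> B_ell2 \<and> (\<forall>v. cinner (x v) v \<in> \<real>\<^sub>\<ge>\<^sub>0)"

definition rank_le :: "nat \<Rightarrow> oper \<Rightarrow> bool" where
  "rank_le n x \<longleftrightarrow> (\<exists>B. finite B \<and> card B \<le> n \<and> range (blinfun_apply x) \<subseteq> ell2.span B)"

text \<open>
  The singular numbers of an arbitrary, not necessarily compact, bounded operator, in the form of
  approximation numbers. Indices start at \<open>0\<close>, so \<open>singular_number x 0\<close> is the operator norm.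
  For compact operators these are the eigenvalues of \<open>\<bar>x\<bar>\<close> in non-increasing order.
\<close>

definition singular_number :: "oper \<Rightarrow> nat \<Rightarrow> real" where
  "singular_number x n = (INF f \<in> {f \<in> B_ell2. rank_le n f}. norm (x - f))"


section \<open>Symmetric sequence spaces and Schatten spaces\<close>

text \<open>
  The rearrangement is indexed from \<open>0\<close>. Values in \<^typ>\<open>ennreal\<close> make it meaningful
  for unbounded sequences as well, where it is constantly \<open>\<infinity>\<close>.
\<close>

definition rearrangement :: "(nat \<Rightarrow> complex) \<Rightarrow> nat \<Rightarrow> ennreal" where
  "rearrangement y n =
     Inf {t. finite {k. t < ennreal (cmod (y k))} \<and> card {k. t < ennreal (cmod (y k))} \<le> n}"

text \<open>
  A sequence space is given by its carrier \<open>E\<close> and its norm \<open>N\<close>; the values of \<open>N\<close> outside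
  \<open>E\<close> are irrelevant.
\<close>

locale symmetric_sequence_space =
  fixes E :: "(nat \<Rightarrow> complex) set" and N :: "(nat \<Rightarrow> complex) \<Rightarrow> real"
  assumes zero_mem: "(\<lambda>_. 0) \<in> E"
    and add_mem: "\<lbrakk>x \<in> E; y \<in> E\<rbrakk> \<Longrightarrow> (\<lambda>k. x k + y k) \<in> E"
    and scale_mem: "x \<in> E \<Longrightarrow> (\<lambda>k. c * x k) \<in> E"
    and norm_nonneg: "x \<in> E \<Longrightarrow> 0 \<le> N x"
    and norm_eq_zero: "x \<in> E \<Longrightarrow> N x = 0 \<longleftrightarrow> x = (\<lambda>_. 0)"
    and norm_triangle: "\<lbrakk>x \<in> E; y \<in> E\<rbrakk> \<Longrightarrow> N (\<lambda>k. x k + y k) \<le> N x + N y"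
    and norm_scale: "x \<in> E \<Longrightarrow> N (\<lambda>k. c * x k) = cmod c * N x"
    and complete: "\<lbrakk>\<And>m. X m \<in> E;
        \<And>e. e > 0 \<Longrightarrow> \<exists>M. \<forall>m\<ge>M. \<forall>n\<ge>M. N (\<lambda>k. X m k - X n k) < e\<rbrakk>
      \<Longrightarrow> \<exists>x\<in>E. (\<lambda>m. N (\<lambda>k. X m k - x k)) \<longlonglongrightarrow> 0"
    and symmetric: "\<lbrakk>x \<in> E; \<And>n. rearrangement y n \<le> rearrangement x n\<rbrakk>
      \<Longrightarrow> y \<in> E \<and> N y \<le> N x"

definition l1 :: "(nat \<Rightarrow> complex) set" where
  "l1 = {x. summable (\<lambda>n. cmod (x n))}"

definition l1_norm :: "(nat \<Rightarrow> complex) \<Rightarrow> real" where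
  "l1_norm x = (\<Sum>n. cmod (x n))"

definition schatten :: "(nat \<Rightarrow> complex) set \<Rightarrow> oper set" where
  "schatten E = {x \<in> B_ell2. (\<lambda>n. complex_of_real (singular_number x n)) \<in> E}"

definition schatten_norm :: "((nat \<Rightarrow> complex) \<Rightarrow> real) \<Rightarrow> oper \<Rightarrow> real" where
  "schatten_norm N x = N (\<lambda>n. complex_of_real (singular_number x n))"


section \<open>Maps on Schatten spaces\<close>

text \<open>
  A map from \<open>S\<^sub>1\<close> to \<open>S\<^sub>E\<close> is a function on \<^typ>\<open>oper\<close> of which only the values on
  \<open>schatten l1\<close> matter.
\<close>

definition bounded_map ::
  "(nat \<Rightarrow> complex) set \<Rightarrow> ((nat \<Rightarrow> complex) \<Rightarrow> real) \<Rightarrow> (oper \<Rightarrow> oper) \<Rightarrow> bool" where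
  "bounded_map E N T \<longleftrightarrow>
     (\<forall>x\<in>schatten l1. T x \<in> schatten E) \<and>
     (\<forall>x\<in>schatten l1. \<forall>y\<in>schatten l1. T (x + y) = T x + T y) \<and>
     (\<forall>c. \<forall>x\<in>schatten l1. T (scaleC_oper c x) = scaleC_oper c (T x)) \<and>
     (\<exists>C. \<forall>x\<in>schatten l1. schatten_norm N (T x) \<le> C * schatten_norm l1_norm x)"

definition schur_multiplier ::
  "(nat \<Rightarrow> complex) set \<Rightarrow> ((nat \<Rightarrow> complex) \<Rightarrow> real) \<Rightarrow> (nat \<Rightarrow> nat \<Rightarrow> complex)
    \<Rightarrow> (oper \<Rightarrow> oper) \<Rightarrow> bool" where
  "schur_multiplier E N \<phi> T \<longleftrightarrow>
     bounded_map E N T \<and>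
     (\<forall>x\<in>schatten l1. \<forall>i j. entry (T x) i j = \<phi> i j * entry x i j)"

definition pos_map :: "(oper \<Rightarrow> oper) \<Rightarrow> bool" where
  "pos_map T \<longleftrightarrow> (\<forall>x\<in>schatten l1. pos_oper x \<longrightarrow> pos_oper (T x))"

definition oper_map_le :: "(oper \<Rightarrow> oper) \<Rightarrow> (oper \<Rightarrow> oper) \<Rightarrow> bool" where
  "oper_map_le T S \<longleftrightarrow> pos_map (\<lambda>x. S x - T x)"

definition bounded_functional :: "(oper \<Rightarrow> complex) \<Rightarrow> bool" where
  "bounded_functional f \<longleftrightarrow>
     (\<forall>x\<in>schatten l1. \<forall>y\<in>schatten l1. f (x + y) = f x + f y) \<and>
     (\<forall>c. \<forall>x\<in>schatten l1. f (scaleC_oper c x) = c * f x) \<and>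
     (\<exists>C. \<forall>x\<in>schatten l1. cmod (f x) \<le> C * schatten_norm l1_norm x)"

definition weakly_null :: "(nat \<Rightarrow> oper) \<Rightarrow> bool" where
  "weakly_null X \<longleftrightarrow>
     (\<forall>n. X n \<in> schatten l1) \<and> (\<forall>f. bounded_functional f \<longrightarrow> (\<lambda>n. f (X n)) \<longlonglongrightarrow> 0)"

definition dunford_pettis ::
  "((nat \<Rightarrow> complex) \<Rightarrow> real) \<Rightarrow> (oper \<Rightarrow> oper) \<Rightarrow> bool" where
  "dunford_pettis N T \<longleftrightarrow>
     (\<forall>X. weakly_null X \<longrightarrow> (\<lambda>n. schatten_norm N (T (X n))) \<longlonglongrightarrow> 0)"

end

theory Submission
  imports Defs
begin

text \<open>
  For a symmetric sequence space that is not zero, a Schur multiplier on trace class operators is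
  Dunford--Pettis if and only if every row and every column of its symbol tends to zero, and this
  property passes from a positive semidefinite kernel \<open>\<psi>\<close> with bounded diagonal to a positive
  semidefinite kernel \<open>\<phi> \<le> \<psi>\<close>.

  The condition is necessary because the matrix units of a column form a weakly null sequence, and
  the multiplier scales them by the entries of the symbol (\<open>dunford_pettis_symbol_tendsto\<close>).
  Positivity of the multipliers \<open>S\<^sub>\<phi>\<close> and \<open>S\<^sub>\<psi> - S\<^sub>\<phi>\<close> means that \<open>\<phi>\<close> and \<open>\<psi> - \<phi>\<close> are positive semidefinite,
  and for such kernels domination carries the vanishing of the columns from \<open>\<psi>\<close> over to \<open>\<phi>\<close>
  (\<open>psd_kernel_dominated_tendsto\<close>); the rows follow since \<open>\<phi>\<close> is Hermitian.

  For sufficiency (\<open>dunford_pettis_of_symbol_tendsto\<close>), let \<open>X n\<close> be weakly null. The trace norm of the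
  corner of \<open>X n\<close> obtained by deleting the first \<open>a\<close> rows and columns is small, uniformly for large \<open>n\<close>, if \<open>a\<close>
  is large (\<open>weakly_null_corners_small\<close>), and the multiplier is bounded on it. What remains of the
  image of \<open>X n\<close> lives on finitely many rows and columns, where the multiplier acts as compact diagonal
  operators on \<open>\<ell>\<^sub>2\<close>; so it tends to zero in operator norm, and its rank is at most \<open>2 * a\<close>
  (\<open>schatten_norm_perturb\<close>).

  The statement on corners is a gliding hump argument (\<open>gliding_hump\<close>) that rests on trace duality: for
  finite orthonormal families, \<open>\<Sum>\<bar>\<langle>x u\<^sub>l, v\<^sub>l\<rangle>\<bar>\<close> is at most the trace norm of \<open>x\<close>
  (\<open>sum_cinner_le_trace_norm\<close>), and the trace norm of a finite section is attained in this way
  (\<open>trace_norm_section_attained\<close>). Since singular numbers are defined here as approximation numbers,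
  both are derived from a singular value decomposition of finite matrices
  (\<open>singular_value_decomposition\<close>).
\<close>


section \<open>The inner product of \<open>\<ell>\<^sub>2\<close>\<close>

lemma coord_add [simp]: "coord (x + y) n = coord x n + coord y n"
  by transfer simp

lemma coord_diff [simp]: "coord (x - y) n = coord x n - coord y n"
  by transfer simp

lemma coord_zero [simp]: "coord 0 n = 0"
  by transfer simp

lemma coord_scaleC [simp]: "coord (c *\<^sub>C x) n = c * coord x n"
  by transfer simp

lemma coord_unit_vec [simp]: "coord (unit_vec k) n = (if n = k then 1 else 0)"
  by transfer simp

lemma coord_sum [simp]: "coord (\<Sum>i\<in>I. f i) n = (\<Sum>i\<in>I. coord (f i) n)"
  by (induction I rule: infinite_finite_induct) auto

lemma scaleR_eq_scaleC: "r *\<^sub>R (x :: ell2) = complex_of_real r *\<^sub>C x"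
  by (simp add: scaleR_ell2_def)

lemma cinner_add_left: "cinner (x + y) z = cinner x z + cinner y z"
  unfolding cinner.rep_eq coord_add
  by (subst suminf_add[OF cinner_summable cinner_summable]) (simp add: algebra_simps)

lemma cinner_scale_left [simp]: "cinner (c *\<^sub>C x) y = c * cinner x y"
  unfolding cinner.rep_eq coord_scaleC
  by (subst suminf_mult[OF cinner_summable, symmetric]) (simp add: algebra_simps)

lemma cinner_commute: "cinner x y = cnj (cinner y x)"
proof -
  have "(\<lambda>n. cnj (coord y n * cnj (coord x n))) sums cnj (cinner y x)"
    unfolding cinner.rep_eq sums_cnj by (intro summable_sums cinner_summable)
  then show ?thesis
    unfolding cinner.rep_eq[of x] by (simp add: sums_iff mult.commute)
qed

lemma cinner_add_right: "cinner x (y + z) = cinner x y + cinner x z"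
  by (metis cinner_add_left cinner_commute complex_cnj_add)

lemma cinner_scale_right [simp]: "cinner x (c *\<^sub>C y) = cnj c * cinner x y"
  by (metis cinner_scale_left cinner_commute complex_cnj_mult)

lemma cinner_zero_left [simp]: "cinner 0 y = 0"
  by (simp add: cinner.rep_eq)

lemma cinner_zero_right [simp]: "cinner y 0 = 0"
  by (simp add: cinner.rep_eq)

lemma cinner_diff_left: "cinner (x - y) z = cinner x z - cinner y z"
  by (metis add_diff_cancel cinner_add_left diff_add_cancel)

lemma cinner_diff_right: "cinner z (x - y) = cinner z x - cinner z y"
  by (metis add_diff_cancel cinner_add_right diff_add_cancel)

lemma cinner_sum_left: "cinner (\<Sum>i\<in>I. f i) y = (\<Sum>i\<in>I. cinner (f i) y)"
  by (induction I rule: infinite_finite_induct) (auto simp: cinner_add_left)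

lemma cinner_sum_right: "cinner y (\<Sum>i\<in>I. f i) = (\<Sum>i\<in>I. cinner y (f i))"
  by (induction I rule: infinite_finite_induct) (auto simp: cinner_add_right)

lemma cinner_self: "cinner x x = complex_of_real ((norm x)\<^sup>2)"
proof -
  have "cinner x x = cnj (cinner x x)"
    by (rule cinner_commute)
  then have "Im (cinner x x) = 0"
    by (metis Reals_cnj_iff complex_is_Real_iff)
  moreover have "Re (cinner x x) = (norm x)\<^sup>2"
    by (metis inner_ell2_def power2_norm_eq_inner)
  ultimately show ?thesis
    by (simp add: complex_eq_iff)
qed

lemma norm_add_sq: "(norm (x + y :: ell2))\<^sup>2 = (norm x)\<^sup>2 + 2 * Re (cinner x y) + (norm y)\<^sup>2"
  using inner_commute[of x y]
  by (simp add: power2_norm_eq_inner inner_add_left inner_add_right flip: inner_ell2_def)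

lemma norm_cinner_le: "cmod (cinner x y) \<le> norm x * norm y"
proof (cases "cinner x y = 0")
  case False
  define c where "c = cnj (cinner x y) / cmod (cinner x y)"
  have "cnj (cinner x y) * cinner x y = complex_of_real (cmod (cinner x y)) * cmod (cinner x y)"
    using complex_norm_square[of "cinner x y"] by (simp add: power2_eq_square mult.commute)
  then have "complex_of_real (cmod (cinner x y)) = cinner (c *\<^sub>C x) y"
    using False by (simp add: c_def)
  then have "cmod (cinner x y) = inner (c *\<^sub>C x) y"
    by (metis Re_complex_of_real inner_ell2_def)
  also have "\<dots> \<le> norm (c *\<^sub>C x) * norm y"
    by (rule norm_cauchy_schwarz)
  also have "norm (c *\<^sub>C x) = norm x"
    using False by (simp add: c_def norm_scaleC norm_divide)
  finally show ?thesis .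
qed (simp add: mult_nonneg_nonneg)

lemma bounded_linear_cinner_left: "bounded_linear (\<lambda>v. cinner v z)"
  by (rule bounded_linear_intro[where K = "norm z"])
    (auto simp: cinner_add_left scaleR_eq_scaleC scaleR_conv_of_real norm_cinner_le)

lemma cinner_unit_vec_right [simp]: "cinner x (unit_vec k) = coord x k"
proof -
  have "(\<lambda>n. coord x n * cnj (coord (unit_vec k) n)) = (\<lambda>n. if n = k then coord x n else 0)"
    by auto
  then show ?thesis
    unfolding cinner.rep_eq by (simp add: sums_unique[OF sums_single, symmetric])
qed

lemma cinner_unit_vec_left: "cinner (unit_vec k) x = cnj (coord x k)"
  by (metis cinner_commute cinner_unit_vec_right)

lemma norm_unit_vec [simp]: "norm (unit_vec k) = 1"
  by (simp add: norm_eq_sqrt_inner inner_ell2_def)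

lemma cmod_coord_le: "cmod (coord x k) \<le> norm x"
  using norm_cinner_le[of x "unit_vec k"] by simp

lemma norm_sq_sums: "(\<lambda>n. (cmod (coord x n))\<^sup>2) sums (norm x)\<^sup>2"
  by (simp add: norm_ell2_def suminf_nonneg coord_summable summable_sums)

lemma norm_le_of_coord:
  assumes "\<And>n. cmod (coord x n) \<le> cmod (coord y n)"
  shows "norm x \<le> norm y"
proof -
  have "(norm x)\<^sup>2 \<le> (norm y)\<^sup>2"
    by (rule sums_le[OF _ norm_sq_sums norm_sq_sums]) (simp add: assms power_mono)
  then show ?thesis
    by (rule power2_le_imp_le) simp
qed

lemma norm_le_of_cinner:
  assumes "0 \<le> K" "\<And>w. cmod (cinner x w) \<le> K * norm w"
  shows "norm x \<le> K"
proof (cases "x = 0")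
  case False
  have "norm x * norm x \<le> K * norm x"
    using assms(2)[of x] by (simp add: cinner_self power2_eq_square norm_mult)
  then show ?thesis
    using False by simp
qed (use assms in simp)


section \<open>Bounded complex-linear operators\<close>

lemma B_ell2_iff: "x \<in> B_ell2 \<longleftrightarrow> (\<forall>c v. x (c *\<^sub>C v) = c *\<^sub>C x v)"
  unfolding B_ell2_def Vector_Spaces.linear_iff
  using ell2.vector_space_axioms by (auto simp: blinfun.add_right)

lemma B_ell2_scaleC: "x \<in> B_ell2 \<Longrightarrow> x (c *\<^sub>C v) = c *\<^sub>C x v"
  by (simp add: B_ell2_iff)

lemma B_ell2_add: "x \<in> B_ell2 \<Longrightarrow> y \<in> B_ell2 \<Longrightarrow> x + y \<in> B_ell2"
  by (simp add: B_ell2_iff blinfun.add_left ell2.scale_right_distrib)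

lemma B_ell2_zero: "0 \<in> B_ell2"
  by (simp add: B_ell2_iff)

lemma B_ell2_compose: "x \<in> B_ell2 \<Longrightarrow> y \<in> B_ell2 \<Longrightarrow> x o\<^sub>L y \<in> B_ell2"
  by (simp add: B_ell2_iff)

lemma B_ell2_sum: "(\<And>i. i \<in> I \<Longrightarrow> x i \<in> B_ell2) \<Longrightarrow> (\<Sum>i\<in>I. x i) \<in> B_ell2"
  by (induction I rule: infinite_finite_induct) (auto intro: B_ell2_add B_ell2_zero)

lemma cinner_blinfun_le: "cmod (cinner (x v) w) \<le> norm x * norm v * norm w" for x :: oper
  by (meson norm_cinner_le norm_blinfun mult_right_mono norm_ge_zero order_trans)

text \<open>The rank-one operator \<open>v \<mapsto> \<langle>v, z\<rangle> w\<close>.\<close>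

definition rank_one :: "ell2 \<Rightarrow> ell2 \<Rightarrow> oper" where
  "rank_one w z = Blinfun (\<lambda>v. cinner v z *\<^sub>C w)"

lemma rank_one_apply [simp]: "rank_one w z v = cinner v z *\<^sub>C w"
proof -
  have "bounded_linear (\<lambda>v. cinner v z *\<^sub>C w)"
    by (rule bounded_linear_intro[where K = "norm z * norm w"])
      (auto simp: cinner_add_left ell2.scale_left_distrib scaleR_eq_scaleC norm_scaleC
        mult.assoc[symmetric] intro!: mult_right_mono norm_cinner_le)
  then show ?thesis
    by (simp add: rank_one_def bounded_linear_Blinfun_apply)
qed

lemma rank_one_in_B_ell2 [simp]: "rank_one w z \<in> B_ell2"
  by (simp add: B_ell2_iff)

lemma norm_rank_one_le: "norm (rank_one w z) \<le> norm w * norm z"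
  by (rule norm_blinfun_bound)
    (auto simp: norm_scaleC mult.assoc intro!: mult_nonneg_nonneg
      order_trans[OF mult_right_mono[OF norm_cinner_le]])

lemma entry_rank_one: "entry (rank_one w z) i j = coord w i * cnj (coord z j)"
  by (simp add: entry_def cinner_unit_vec_left)

text \<open>The orthogonal projection onto the closed span of the basis vectors with index in \<open>F\<close>.\<close>

lift_definition restr :: "nat set \<Rightarrow> ell2 \<Rightarrow> ell2" is "\<lambda>F x n. if n \<in> F then x n else 0"
proof -
  fix F :: "nat set" and x :: "nat \<Rightarrow> complex"
  assume "summable (\<lambda>n. (cmod (x n))\<^sup>2)"
  then show "summable (\<lambda>n. (cmod (if n \<in> F then x n else 0))\<^sup>2)"
    by (rule summable_comparison_test'[where N = 0]) auto
qed

definition proj :: "nat set \<Rightarrow> oper" where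
  "proj F = Blinfun (restr F)"

lemma coord_proj [simp]: "coord (proj F x) n = (if n \<in> F then coord x n else 0)"
proof -
  have "bounded_linear (restr F)"
    by (rule bounded_linear_intro[where K = 1])
      (auto simp: restr.rep_eq scaleR_eq_scaleC intro!: coord_eqI norm_le_of_coord)
  then show ?thesis
    by (simp add: proj_def bounded_linear_Blinfun_apply restr.rep_eq)
qed

lemma proj_in_B_ell2 [simp]: "proj F \<in> B_ell2"
  by (auto simp: B_ell2_iff intro: coord_eqI)

lemma norm_proj_apply_le: "norm (proj F v) \<le> norm v"
  by (rule norm_le_of_coord) auto

lemma norm_proj_le: "norm (proj F) \<le> 1"
  by (rule norm_blinfun_bound) (auto intro: norm_proj_apply_le)

lemma proj_proj [simp]: "proj F (proj G v) = proj (F \<inter> G) v"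
  by (rule coord_eqI) auto

lemma proj_compl: "proj (- F) v = v - proj F v"
  by (rule coord_eqI) auto

lemma cinner_proj: "cinner (proj F v) w = cinner v (proj F w)"
  unfolding cinner.rep_eq by (intro arg_cong[where f = suminf]) auto

lemma proj_finite:
  assumes "finite F"
  shows "proj F v = (\<Sum>i\<in>F. coord v i *\<^sub>C unit_vec i)"
  by (rule coord_eqI) (use assms in \<open>auto simp: if_distrib cong: if_cong\<close>)

lemma norm_diff_proj_tendsto: "(\<lambda>m. norm (v - proj {..<m} v)) \<longlonglongrightarrow> 0"
proof -
  have eq: "(norm (v - proj {..<m} v))\<^sup>2 = (norm v)\<^sup>2 - (\<Sum>n<m. (cmod (coord v n))\<^sup>2)" for m
  proof -
    have "(\<lambda>n. if n \<in> {..<m} then (cmod (coord v n))\<^sup>2 else 0) sums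
        (\<Sum>n<m. (cmod (coord v n))\<^sup>2)"
      by (rule sums_If_finite_set) simp
    from sums_diff[OF norm_sq_sums[of v] this]
    have "(\<lambda>n. (cmod (coord (v - proj {..<m} v) n))\<^sup>2) sums
        ((norm v)\<^sup>2 - (\<Sum>n<m. (cmod (coord v n))\<^sup>2))"
      by (rule sums_cong[THEN iffD1, rotated]) auto
    then show ?thesis
      using norm_sq_sums sums_unique2 by blast
  qed
  have "(\<lambda>m. (norm v)\<^sup>2 - (\<Sum>n<m. (cmod (coord v n))\<^sup>2)) \<longlonglongrightarrow> (norm v)\<^sup>2 - (norm v)\<^sup>2"
    using norm_sq_sums[of v] unfolding sums_def by (intro tendsto_intros)
  then have "(\<lambda>m. sqrt ((norm (v - proj {..<m} v))\<^sup>2)) \<longlonglongrightarrow> sqrt 0"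
    unfolding eq by (intro tendsto_real_sqrt) simp
  then show ?thesis
    by simp
qed

lemma proj_tendsto: "(\<lambda>m. proj {..<m} v) \<longlonglongrightarrow> v"
proof -
  have "(\<lambda>m. proj {..<m} v - v) \<longlonglongrightarrow> 0"
    using norm_diff_proj_tendsto[of v] unfolding norm_minus_commute[of v]
    by (rule tendsto_norm_zero_cancel)
  then show ?thesis
    by (rule LIM_zero_cancel)
qed

text \<open>An operator is determined by its matrix, since finitely supported vectors are dense.\<close>

lemma B_ell2_eqI:
  assumes "x \<in> B_ell2" "y \<in> B_ell2" "\<And>i j. entry x i j = entry y i j"
  shows "x = y"
proof (rule blinfun_eqI)
  fix v
  have e: "x (unit_vec j) = y (unit_vec j)" for j
    using assms(3) by (intro coord_eqI) (simp add: entry_def)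
  have eq: "x (proj {..<m} v) = y (proj {..<m} v)" for m
    by (simp add: proj_finite blinfun.sum_right B_ell2_scaleC assms e)
  have "(\<lambda>m. x (proj {..<m} v)) \<longlonglongrightarrow> x v" "(\<lambda>m. y (proj {..<m} v)) \<longlonglongrightarrow> y v"
    by (intro blinfun.tendsto tendsto_const proj_tendsto)+
  then show "x v = y v"
    unfolding eq by (rule LIMSEQ_unique)
qed

lemma entry_proj: "x \<in> B_ell2 \<Longrightarrow>
    entry (proj F o\<^sub>L x o\<^sub>L proj G) i j = (if i \<in> F \<and> j \<in> G then entry x i j else 0)"
proof -
  assume "x \<in> B_ell2"
  have "proj G (unit_vec j) = (if j \<in> G then unit_vec j else 0)"
    by (rule coord_eqI) auto
  then show ?thesis
    by (simp add: entry_def)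
qed


section \<open>Orthonormal families\<close>

text \<open>Orthonormality of an indexed family. The index type is arbitrary, so that families of vectors
  supported in different blocks of coordinates can be joined into one.\<close>

definition orthonormal :: "'i set \<Rightarrow> ('i \<Rightarrow> ell2) \<Rightarrow> bool" where
  "orthonormal I u \<longleftrightarrow> (\<forall>i\<in>I. \<forall>j\<in>I. cinner (u i) (u j) = (if i = j then 1 else 0))"

lemma orthonormalD:
  "orthonormal I u \<Longrightarrow> i \<in> I \<Longrightarrow> j \<in> I \<Longrightarrow> cinner (u i) (u j) = (if i = j then 1 else 0)"
  by (simp add: orthonormal_def)

lemma norm_orthonormal: "orthonormal I u \<Longrightarrow> i \<in> I \<Longrightarrow> norm (u i) = 1"
  by (simp add: orthonormal_def norm_eq_sqrt_inner inner_ell2_def)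

lemma cinner_comb_orthonormal:
  assumes "orthonormal I u" "finite I" "j \<in> I"
  shows "cinner (\<Sum>i\<in>I. c i *\<^sub>C u i) (u j) = c j"
proof -
  have "cinner (\<Sum>i\<in>I. c i *\<^sub>C u i) (u j) = (\<Sum>i\<in>I. if i = j then c i else 0)"
    unfolding cinner_sum_left cinner_scale_left
    by (rule sum.cong) (use assms in \<open>auto simp: orthonormalD\<close>)
  then show ?thesis
    using assms by simp
qed

lemma norm_comb_orthonormal:
  assumes "orthonormal I u" "finite I"
  shows "(norm (\<Sum>i\<in>I. c i *\<^sub>C u i))\<^sup>2 = (\<Sum>i\<in>I. (cmod (c i))\<^sup>2)"
proof -
  have "complex_of_real ((norm (\<Sum>i\<in>I. c i *\<^sub>C u i))\<^sup>2) = (\<Sum>j\<in>I. cnj (c j) * c j)"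
    unfolding cinner_self[symmetric] cinner_sum_right[of "\<Sum>i\<in>I. c i *\<^sub>C u i"] cinner_scale_right
    by (rule sum.cong) (use assms in \<open>auto simp: cinner_comb_orthonormal\<close>)
  also have "\<dots> = complex_of_real (\<Sum>i\<in>I. (cmod (c i))\<^sup>2)"
    by (simp add: complex_norm_square mult.commute del: of_real_power)
  finally show ?thesis
    using of_real_eq_iff by blast
qed

text \<open>Bessel's inequality.\<close>

lemma bessel:
  assumes "orthonormal I u" "finite I"
  shows "(\<Sum>i\<in>I. (cmod (cinner w (u i)))\<^sup>2) \<le> (norm w)\<^sup>2"
proof -
  define p where "p = (\<Sum>i\<in>I. cinner w (u i) *\<^sub>C u i)"
  have p: "(norm p)\<^sup>2 = (\<Sum>i\<in>I. (cmod (cinner w (u i)))\<^sup>2)"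
    unfolding p_def by (rule norm_comb_orthonormal[OF assms])
  have "cinner (w - p) (u i) = 0" if "i \<in> I" for i
    using cinner_comb_orthonormal[OF assms that] by (simp add: p_def cinner_diff_left)
  then have "cinner (w - p) p = 0"
    by (subst (2) p_def) (simp add: cinner_sum_right)
  then have "(norm w)\<^sup>2 = (norm (w - p))\<^sup>2 + (norm p)\<^sup>2"
    using norm_add_sq[of "w - p" p] by simp
  then show ?thesis
    unfolding p[symmetric] by simp
qed

lemma bessel_left:
  assumes "orthonormal I u" "finite I"
  shows "(\<Sum>i\<in>I. (cmod (cinner (u i) w))\<^sup>2) \<le> (norm w)\<^sup>2"
  using bessel[OF assms, of w] by (subst cinner_commute) simp

text \<open>Gram--Schmidt. The set \<open>S G\<close> of vectors that equal their Fourier sum over \<open>G\<close> is a subspace,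
  so it suffices that it contains \<open>B\<close>.\<close>

lemma gram_schmidt:
  assumes "finite B"
  obtains G where "finite G" "orthonormal G (\<lambda>g. g)"
    "\<And>v. v \<in> ell2.span B \<Longrightarrow> v = (\<Sum>g\<in>G. cinner v g *\<^sub>C g)"
proof -
  define S where "S G = {v. v = (\<Sum>g\<in>G. cinner v g *\<^sub>C g)}" for G
  have sub: "ell2.subspace (S G)" for G
  proof (rule ell2.subspaceI)
    fix c v assume "v \<in> S G"
    then have "c *\<^sub>C v = c *\<^sub>C (\<Sum>g\<in>G. cinner v g *\<^sub>C g)"
      unfolding S_def by (intro arg_cong[where f = "\<lambda>v. c *\<^sub>C v"]) simp
    then show "c *\<^sub>C v \<in> S G"
      unfolding S_def mem_Collect_eq cinner_scale_left ell2.scale_sum_right ell2.scale_scale .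
  qed (auto simp: S_def cinner_add_left ell2.scale_left_distrib sum.distrib)
  have "\<exists>G. finite G \<and> orthonormal G (\<lambda>g. g) \<and> B \<subseteq> S G"
    using assms
  proof (induction B)
    case empty
    show ?case
      by (rule exI[of _ "{}"]) (simp add: orthonormal_def)
  next
    case (insert b B)
    then obtain G where G: "finite G" "orthonormal G (\<lambda>g. g)" "B \<subseteq> S G"
      by blast
    define r where "r = b - (\<Sum>g\<in>G. cinner b g *\<^sub>C g)"
    have rg: "cinner r g = 0" if "g \<in> G" for g
      using cinner_comb_orthonormal[OF G(2,1) that, of "cinner b"]
      by (simp add: r_def cinner_diff_left)
    show ?case
    proof (cases "r = 0")
      case True
      then have "b \<in> S G"
        by (simp add: r_def S_def)
      then show ?thesis
        using G by blast
    next
      case False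
      define g0 where "g0 = complex_of_real (inverse (norm r)) *\<^sub>C r"
      have n0: "cinner g0 g0 = 1"
        using False by (simp add: g0_def cinner_self norm_scaleC norm_inverse)
      have g0g: "cinner g0 g = 0" "cinner g g0 = 0" if "g \<in> G" for g
        using rg[OF that] cinner_commute[of g g0] by (simp_all add: g0_def)
      have "g0 \<notin> G"
        using g0g(1)[of g0] n0 by auto
      have "orthonormal (insert g0 G) (\<lambda>g. g)"
        using n0 g0g \<open>g0 \<notin> G\<close> G(2) by (simp add: orthonormal_def) blast
      moreover have "S G \<subseteq> S (insert g0 G)"
      proof
        fix v assume "v \<in> S G"
        then have v: "v = (\<Sum>g\<in>G. cinner v g *\<^sub>C g)"
          by (simp add: S_def)
        have "cinner v g0 = 0"
          by (subst v) (simp add: cinner_sum_left g0g)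
        then show "v \<in> S (insert g0 G)"
          using v G(1) \<open>g0 \<notin> G\<close> by (simp add: S_def)
      qed
      moreover have "b \<in> S (insert g0 G)"
      proof -
        have b: "b = (\<Sum>g\<in>G. cinner b g *\<^sub>C g) + r"
          by (simp add: r_def)
        have "cinner b g0 = cinner r g0"
          by (subst b) (simp add: cinner_add_left cinner_sum_left g0g)
        also have "\<dots> = norm r"
          using False by (simp add: g0_def cinner_self power2_eq_square)
        finally have "cinner b g0 *\<^sub>C g0 = r"
          using False by (simp add: g0_def)
        then show ?thesis
          using b G(1) \<open>g0 \<notin> G\<close> by (simp add: S_def add.commute)
      qed
      ultimately show ?thesis
        using G by (intro exI[of _ "insert g0 G"]) auto
    qed
  qed
  then obtain G where G: "finite G" "orthonormal G (\<lambda>g. g)" "B \<subseteq> S G"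
    by blast
  then have "ell2.span B \<subseteq> S G"
    using sub by (intro ell2.span_minimal)
  with G show ?thesis
    by (intro that[of G]) (auto simp: S_def)
qed


section \<open>Riesz representation\<close>

lemma additive_finite_sum:
  fixes g :: "'a :: comm_monoid_add \<Rightarrow> complex"
  assumes "\<And>v w. g (v + w) = g v + g w" "finite I"
  shows "g (\<Sum>i\<in>I. f i) = (\<Sum>i\<in>I. g (f i))"
proof -
  have "g 0 = 0"
    using assms(1)[of 0 0] by simp
  with assms(2) show ?thesis
    by induction (auto simp: assms(1))
qed

text \<open>The values of a bounded functional on the basis are square summable: evaluate it at the
  finitely supported vector whose coordinates are the conjugates of these values.\<close>

lemma functional_square_summable:
  fixes g :: "ell2 \<Rightarrow> complex"
  assumes add: "\<And>v w. g (v + w) = g v + g w" and scale: "\<And>c v. g (c *\<^sub>C v) = c * g v"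
    and bound: "\<And>v. cmod (g v) \<le> C * norm v"
  shows "summable (\<lambda>k. (cmod (g (unit_vec k)))\<^sup>2)"
proof (rule summableI_nonneg_bounded)
  fix K
  define S where "S = (\<Sum>k<K. (cmod (g (unit_vec k)))\<^sup>2)"
  define v where "v = (\<Sum>k<K. cnj (g (unit_vec k)) *\<^sub>C unit_vec k)"
  have S0: "0 \<le> S"
    by (simp add: S_def sum_nonneg)
  have on: "orthonormal {..<K} unit_vec"
    by (simp add: orthonormal_def)
  have "(norm v)\<^sup>2 = S"
    unfolding v_def S_def by (subst norm_comb_orthonormal[OF on]) auto
  then have nv: "norm v = sqrt S"
    by (metis norm_ge_zero real_sqrt_unique)
  have "g v = complex_of_real S"
    unfolding v_def S_def
    by (subst additive_finite_sum[OF add])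
      (auto simp: scale complex_norm_square mult.commute simp del: of_real_power)
  then have "S \<le> C * sqrt S"
    using bound[of v] S0 nv by simp
  then have "sqrt S * sqrt S \<le> C * sqrt S"
    using S0 by simp
  then have "sqrt S \<le> \<bar>C\<bar>"
  proof (cases "S = 0")
    case False
    then have "0 < sqrt S"
      using S0 by simp
    with \<open>sqrt S * sqrt S \<le> C * sqrt S\<close> show ?thesis
      by (simp only: mult_le_cancel_right_pos)
  qed simp
  then have "(sqrt S)\<^sup>2 \<le> \<bar>C\<bar>\<^sup>2"
    using S0 by (intro power_mono) auto
  then show "(\<Sum>k<K. (cmod (g (unit_vec k)))\<^sup>2) \<le> C\<^sup>2"
    using S0 by (simp add: S_def)
qed simp

lemma riesz:
  fixes g :: "ell2 \<Rightarrow> complex"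
  assumes add: "\<And>v w. g (v + w) = g v + g w" and scale: "\<And>c v. g (c *\<^sub>C v) = c * g v"
    and bound: "\<And>v. cmod (g v) \<le> C * norm v"
  obtains z where "\<And>v. g v = cinner v z"
proof -
  define z where "z = Abs_ell2 (\<lambda>k. cnj (g (unit_vec k)))"
  have z: "coord z k = cnj (g (unit_vec k))" for k
    unfolding z_def using functional_square_summable[OF assms] by (subst Abs_ell2_inverse) auto
  have "g v = cinner v z" for v
  proof -
    have eq: "g (proj {..<m} v) = cinner (proj {..<m} v) z" for m
      by (simp add: proj_finite additive_finite_sum[OF add] scale cinner_sum_left
          cinner_unit_vec_left z)
    have "bounded_linear g"
      by (rule bounded_linear_intro[where K = C])
        (auto simp: add scaleR_eq_scaleC scale scaleR_conv_of_real bound mult.commute)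
    then have "(\<lambda>m. g (proj {..<m} v)) \<longlonglongrightarrow> g v"
      "(\<lambda>m. cinner (proj {..<m} v) z) \<longlonglongrightarrow> cinner v z"
      using bounded_linear_cinner_left by (auto intro: bounded_linear.tendsto proj_tendsto)
    then show ?thesis
      unfolding eq by (rule LIMSEQ_unique)
  qed
  then show ?thesis
    by (rule that)
qed


section \<open>Singular numbers\<close>

lemma rank_le_zero [simp]: "rank_le n 0"
  unfolding rank_le_def by (rule exI[of _ "{}"]) (simp add: ell2.span_zero)

lemma rank_le_mono: "rank_le m x \<Longrightarrow> m \<le> n \<Longrightarrow> rank_le n x"
  unfolding rank_le_def by (meson order_trans)

lemma rank_le_add: "rank_le m x \<Longrightarrow> rank_le n y \<Longrightarrow> rank_le (m + n) (x + y)"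
proof -
  assume "rank_le m x" "rank_le n y"
  then obtain A B where A: "finite A" "card A \<le> m" "range x \<subseteq> ell2.span A"
    and B: "finite B" "card B \<le> n" "range y \<subseteq> ell2.span B"
    unfolding rank_le_def by blast
  have "range (x + y) \<subseteq> ell2.span (A \<union> B)"
    using A(3) B(3) ell2.span_mono[of A "A \<union> B"] ell2.span_mono[of B "A \<union> B"]
    by (auto simp: blinfun.add_left intro!: ell2.span_add)
  moreover have "card (A \<union> B) \<le> m + n"
    using card_Un_le[of A B] A B by linarith
  ultimately show ?thesis
    unfolding rank_le_def using A(1) B(1) by blast
qed

lemma rank_le_rank_one: "rank_le 1 (rank_one w z)"
  unfolding rank_le_def
  by (rule exI[of _ "{w}"]) (auto intro: ell2.span_scale ell2.span_base)

lemma rank_le_sum_rank_one: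
  "finite I \<Longrightarrow> rank_le (card I) (\<Sum>i\<in>I. rank_one (w i) (z i))"
proof (induction I rule: finite_induct)
  case (insert i I)
  then show ?case
    using rank_le_add[OF rank_le_rank_one insert.IH, of "w i" "z i"] by simp
qed simp

lemma rank_le_compose_right: "rank_le n x \<Longrightarrow> rank_le n (x o\<^sub>L a)"
  unfolding rank_le_def by (auto simp: image_subset_iff)

lemma rank_le_compose_left:
  assumes "a \<in> B_ell2" "rank_le n x"
  shows "rank_le n (a o\<^sub>L x)"
proof -
  obtain B where B: "finite B" "card B \<le> n" "range x \<subseteq> ell2.span B"
    using assms(2) unfolding rank_le_def by blast
  have "module_hom scaleC_ell2 scaleC_ell2 (blinfun_apply a)"
    using assms(1) unfolding B_ell2_def Vector_Spaces.linear_def by simp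
  then have "ell2.span (a ` B) = a ` ell2.span B"
    by (rule module_hom.span_image)
  then have "range (a o\<^sub>L x) \<subseteq> ell2.span (a ` B)"
    using B(3) by auto
  then show ?thesis
    unfolding rank_le_def using B card_image_le[of B "blinfun_apply a"]
    by (intro exI[of _ "a ` B"]) auto
qed

lemma singular_number_le:
  assumes "f \<in> B_ell2" "rank_le n f"
  shows "singular_number x n \<le> norm (x - f)"
  unfolding singular_number_def
  by (rule cINF_lower) (use assms in \<open>auto intro: bdd_belowI[of _ 0]\<close>)

lemma singular_number_ge:
  assumes "\<And>f. f \<in> B_ell2 \<Longrightarrow> rank_le n f \<Longrightarrow> K \<le> norm (x - f)"
  shows "K \<le> singular_number x n"
  unfolding singular_number_def
  by (rule cINF_greatest) (use assms B_ell2_zero in auto)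

lemma singular_number_nonneg: "0 \<le> singular_number x n"
  by (rule singular_number_ge) simp

lemma singular_number_approx:
  assumes "singular_number x n < K"
  obtains f where "f \<in> B_ell2" "rank_le n f" "norm (x - f) < K"
  using singular_number_ge[of n K x] assms by (meson not_le)

lemma singular_number_antimono: "m \<le> n \<Longrightarrow> singular_number x n \<le> singular_number x m"
  by (rule singular_number_ge) (auto intro: singular_number_le rank_le_mono)

lemma singular_number_0: "singular_number x 0 = norm x"
proof (rule antisym)
  show "singular_number x 0 \<le> norm x"
    using singular_number_le[of 0 0 x] by (simp add: B_ell2_zero)
  show "norm x \<le> singular_number x 0"
  proof (rule singular_number_ge)
    fix f assume "rank_le 0 f"
    then have "range f \<subseteq> {0}"
      unfolding rank_le_def by auto
    then have "f = 0"
      by (intro blinfun_eqI) (auto simp: image_subset_iff)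
    then show "norm x \<le> norm (x - f)"
      by simp
  qed
qed

lemma singular_number_rank_le: "x \<in> B_ell2 \<Longrightarrow> rank_le n x \<Longrightarrow> singular_number x n = 0"
  using singular_number_le[of x n x] singular_number_nonneg[of x n] by simp

lemma singular_number_perturb: "singular_number x n \<le> singular_number y n + norm (x - y)"
proof -
  have "singular_number x n - norm (x - y) \<le> singular_number y n"
  proof (rule singular_number_ge)
    fix f assume "f \<in> B_ell2" "rank_le n f"
    then have "singular_number x n \<le> norm (x - f)"
      by (rule singular_number_le)
    also have "\<dots> \<le> norm (x - y) + norm (y - f)"
      using norm_triangle_ineq[of "x - y" "y - f"] by simp
    finally show "singular_number x n - norm (x - y) \<le> norm (y - f)"
      by simp
  qed
  then show ?thesis
    by simp
qed

lemma singular_number_add_rank_le: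
  assumes "r \<in> B_ell2" "rank_le k r"
  shows "singular_number (x + r) (n + k) \<le> singular_number x n"
proof (rule singular_number_ge)
  fix f assume "f \<in> B_ell2" "rank_le n f"
  then have "singular_number (x + r) (n + k) \<le> norm ((x + r) - (f + r))"
    using assms by (intro singular_number_le B_ell2_add rank_le_add)
  then show "singular_number (x + r) (n + k) \<le> norm (x - f)"
    by simp
qed

lemma norm_compose_contractions_le:
  fixes a b x :: oper
  assumes "norm a \<le> 1" "norm b \<le> 1"
  shows "norm (a o\<^sub>L x o\<^sub>L b) \<le> norm x"
proof -
  have "norm (a o\<^sub>L x o\<^sub>L b) \<le> norm a * norm x * norm b"
    by (meson norm_blinfun_compose mult_right_mono norm_ge_zero order_trans)
  also have "\<dots> \<le> 1 * norm x * 1"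
    using assms by (intro mult_mono) auto
  finally show ?thesis
    by simp
qed

lemma singular_number_compose_le:
  assumes "a \<in> B_ell2" "norm a \<le> 1" "b \<in> B_ell2" "norm b \<le> 1"
  shows "singular_number (a o\<^sub>L x o\<^sub>L b) n \<le> singular_number x n"
proof (rule singular_number_ge)
  fix f assume "f \<in> B_ell2" "rank_le n f"
  then have "singular_number (a o\<^sub>L x o\<^sub>L b) n \<le> norm ((a o\<^sub>L x o\<^sub>L b) - (a o\<^sub>L f o\<^sub>L b))"
    using assms
    by (intro singular_number_le B_ell2_compose rank_le_compose_left rank_le_compose_right) auto
  also have "(a o\<^sub>L x o\<^sub>L b) - (a o\<^sub>L f o\<^sub>L b) = a o\<^sub>L (x - f) o\<^sub>L b"
    by (rule blinfun_eqI) (simp add: blinfun.diff_left blinfun.diff_right)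
  also have "norm \<dots> \<le> norm (x - f)"
    using assms by (intro norm_compose_contractions_le)
  finally show "singular_number (a o\<^sub>L x o\<^sub>L b) n \<le> norm (x - f)" .
qed


section \<open>Approximation of compact operators by finite matrices\<close>

lemma finite_rank_decomposition:
  assumes f: "f \<in> B_ell2" "rank_le n f"
  obtains G :: "ell2 set" and z where "finite G" "f = (\<Sum>g\<in>G. rank_one g (z g))"
proof -
  obtain B where B: "finite B" "range f \<subseteq> ell2.span B"
    using f(2) unfolding rank_le_def by blast
  obtain G where G: "finite G" "\<And>v. v \<in> ell2.span B \<Longrightarrow> v = (\<Sum>g\<in>G. cinner v g *\<^sub>C g)"
    using gram_schmidt[OF B(1)] by metis
  have "\<exists>z. \<forall>v. cinner (f v) g = cinner v z" for g
  proof -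
    obtain z where "\<And>v. cinner (f v) g = cinner v z"
    proof (rule riesz[where g = "\<lambda>v. cinner (f v) g" and C = "norm f * norm g"])
      show "cmod (cinner (f v) g) \<le> norm f * norm g * norm v" for v
        using cinner_blinfun_le[of f v g] by (simp add: mult_ac)
    qed (auto simp: blinfun.add_right cinner_add_left B_ell2_scaleC f)
    then show ?thesis
      by blast
  qed
  then obtain z where z: "\<And>g v. cinner (f v) g = cinner v (z g)"
    by metis
  have "f v = (\<Sum>g\<in>G. rank_one g (z g)) v" for v
  proof -
    have "f v = (\<Sum>g\<in>G. cinner (f v) g *\<^sub>C g)"
      using B(2) by (intro G(2)) auto
    then show ?thesis
      by (simp add: blinfun.sum_left z)
  qed
  then have "f = (\<Sum>g\<in>G. rank_one g (z g))"
    by (intro blinfun_eqI)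
  with G(1) show ?thesis
    by (rule that)
qed

lemma norm_rank_one_truncation_tendsto:
  "(\<lambda>m. norm (rank_one w z - (proj {..<m} o\<^sub>L rank_one w z o\<^sub>L proj {..<m}))) \<longlonglongrightarrow> 0"
proof (rule tendsto_sandwich[OF _ _ tendsto_const])
  let ?b = "\<lambda>m. norm (w - proj {..<m} w) * norm z + norm w * norm (z - proj {..<m} z)"
  have "norm (rank_one w z - (proj {..<m} o\<^sub>L rank_one w z o\<^sub>L proj {..<m})) \<le> ?b m" for m
  proof -
    have "rank_one w z - (proj {..<m} o\<^sub>L rank_one w z o\<^sub>L proj {..<m}) =
        rank_one (w - proj {..<m} w) z + rank_one (proj {..<m} w) (z - proj {..<m} z)"
      by (rule blinfun_eqI)
        (simp add: blinfun.add_left blinfun.diff_left B_ell2_scaleC cinner_proj cinner_diff_right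
          ell2.scale_right_diff_distrib ell2.scale_left_diff_distrib)
    also have "norm \<dots> \<le> norm (w - proj {..<m} w) * norm z
        + norm (proj {..<m} w) * norm (z - proj {..<m} z)"
      by (meson norm_rank_one_le norm_triangle_ineq add_mono order_trans)
    also have "\<dots> \<le> ?b m"
      by (intro add_left_mono mult_right_mono norm_proj_apply_le norm_ge_zero)
    finally show ?thesis .
  qed
  then show "\<forall>\<^sub>F m in sequentially.
      norm (rank_one w z - (proj {..<m} o\<^sub>L rank_one w z o\<^sub>L proj {..<m})) \<le> ?b m"
    by simp
  have "?b \<longlonglongrightarrow> 0 * norm z + norm w * 0"
    by (intro tendsto_intros norm_diff_proj_tendsto)
  then show "?b \<longlonglongrightarrow> 0"
    by simp
qed simp

text \<open>The finite sections of an operator whose singular numbers tend to zero converge to it in norm: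
  it is within any distance of an operator of finite rank, that is, of a finite sum of rank-one
  operators.\<close>

lemma compact_truncation_tendsto:
  assumes x: "x \<in> B_ell2" and lim: "singular_number x \<longlonglongrightarrow> 0"
  shows "(\<lambda>m. norm (x - (proj {..<m} o\<^sub>L x o\<^sub>L proj {..<m}))) \<longlonglongrightarrow> 0"
proof (rule tendsto_norm_zero, rule LIMSEQ_I)
  fix e :: real assume "0 < e"
  let ?D = "\<lambda>y m. y - (proj {..<m} o\<^sub>L y o\<^sub>L proj {..<m})"
  have "\<forall>\<^sub>F n in sequentially. singular_number x n < e / 3"
    by (rule order_tendstoD(2)[OF lim]) (use \<open>0 < e\<close> in simp)
  then obtain n where "singular_number x n < e / 3"
    using eventually_happens by fastforce
  then obtain f where f: "f \<in> B_ell2" "rank_le n f" "norm (x - f) < e / 3"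
    by (rule singular_number_approx)
  obtain G z where G: "finite G" "f = (\<Sum>g\<in>G. rank_one g (z g))"
    using finite_rank_decomposition[OF f(1,2)] .
  have Df: "?D f m = (\<Sum>g\<in>G. ?D (rank_one g (z g)) m)" for m
    unfolding G(2) by (rule blinfun_eqI)
      (simp add: blinfun.sum_left blinfun.diff_left blinfun.sum_right sum_subtractf)
  have "(\<lambda>m. ?D f m) \<longlonglongrightarrow> (\<Sum>g\<in>G. 0)"
    unfolding Df
    by (intro tendsto_sum tendsto_norm_zero_cancel[OF norm_rank_one_truncation_tendsto])
  then obtain m0 where m0: "\<And>m. m \<ge> m0 \<Longrightarrow> norm (?D f m) < e / 3"
    using LIMSEQ_D[of "?D f" 0 "e / 3"] \<open>0 < e\<close> by auto
  have "norm (?D x m - 0) < e" if "m \<ge> m0" for m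
  proof -
    have "?D x m = (x - f) + ?D f m - (proj {..<m} o\<^sub>L (x - f) o\<^sub>L proj {..<m})"
      by (rule blinfun_eqI) (simp add: blinfun.diff_left blinfun.diff_right blinfun.add_left)
    then have "norm (?D x m) \<le> norm (x - f) + norm (?D f m)
        + norm (proj {..<m} o\<^sub>L (x - f) o\<^sub>L proj {..<m})"
      by (metis (no_types, lifting) norm_triangle_ineq norm_triangle_ineq4 add_right_mono order_trans)
    also have "norm (proj {..<m} o\<^sub>L (x - f) o\<^sub>L proj {..<m}) \<le> norm (x - f)"
      by (intro norm_compose_contractions_le norm_proj_le)
    finally show ?thesis
      using f(3) m0[OF that] by simp
  qed
  then show "\<exists>m0. \<forall>m\<ge>m0. norm (?D x m - 0) < e"
    by blast
qed


section \<open>Singular value decomposition of finite matrices\<close>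

text \<open>The coordinate subspace of a finite index set is finite-dimensional, so its closed bounded
  subsets are compact.\<close>

lemma compact_finite_support_box:
  assumes "finite F"
  shows "compact {w. proj F w = w \<and> (\<forall>i. cmod (coord w i) \<le> 1)}"
  using assms
proof (induction F)
  case empty
  have "{w. proj {} w = w \<and> (\<forall>i. cmod (coord w i) \<le> 1)} = {0}"
  proof -
    have "proj {} w = 0" for w
      by (rule coord_eqI) simp
    then show ?thesis
      by auto
  qed
  then show ?case
    by simp
next
  case (insert k F)
  let ?K = "\<lambda>F. {w. proj F w = w \<and> (\<forall>i. cmod (coord w i) \<le> 1)}"
  let ?L = "(\<lambda>c. c *\<^sub>C unit_vec k) ` cball 0 1"
  have "bounded_linear (\<lambda>c. c *\<^sub>C unit_vec k)"
    by (rule bounded_linear_intro[where K = 1])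
      (auto simp: ell2.scale_left_distrib scaleR_eq_scaleC norm_scaleC scaleR_conv_of_real)
  then have "compact ?L"
    by (intro compact_continuous_image linear_continuous_on compact_cball)
  then have "compact {x + y | x y. x \<in> ?L \<and> y \<in> ?K F}"
    using insert.IH by (rule compact_sums)
  also have "{x + y | x y. x \<in> ?L \<and> y \<in> ?K F} = ?K (insert k F)"
  proof (intro set_eqI iffI)
    fix w assume "w \<in> {x + y | x y. x \<in> ?L \<and> y \<in> ?K F}"
    then obtain c y where w: "w = c *\<^sub>C unit_vec k + y" "cmod c \<le> 1" "proj F y = y"
      "\<And>i. cmod (coord y i) \<le> 1"
      by auto
    have "coord y i = 0" if "i \<notin> F" for i
      using w(3) that by (metis coord_proj)
    then show "w \<in> ?K (insert k F)"
      using w insert.hyps by (auto intro!: coord_eqI)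
  next
    fix w assume w: "w \<in> ?K (insert k F)"
    have "coord w i = 0" if "i \<notin> insert k F" for i
      using w that by (metis (mono_tags) coord_proj mem_Collect_eq)
    then have "w = coord w k *\<^sub>C unit_vec k + proj F w"
      using insert.hyps by (intro coord_eqI) auto
    moreover have "proj F w \<in> ?K F"
      using w by auto
    ultimately show "w \<in> {x + y | x y. x \<in> ?L \<and> y \<in> ?K F}"
      using w by force
  qed
  finally show ?case .
qed

text \<open>A unit vector at which an operator attains its norm on a subspace is mapped to a vector
  orthogonal to the images of all vectors orthogonal to it: otherwise the norm would increase to
  first order in the direction of such a vector.\<close>

lemma cinner_image_eq_zero_of_maximal:
  assumes y: "y \<in> B_ell2" and u: "norm u = 1" "norm (y u) = \<sigma>"
    and max: "\<And>t. norm (y (u + t *\<^sub>C w)) \<le> \<sigma> * norm (u + t *\<^sub>C w)"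
    and orth: "cinner w u = 0"
  shows "cinner (y w) (y u) = 0"
proof (rule ccontr)
  define a where "a = cinner (y w) (y u)"
  assume "cinner (y w) (y u) \<noteq> 0"
  then have a: "0 < (cmod a)\<^sup>2"
    by (simp add: a_def)
  have uw: "cinner u w = 0"
    using orth cinner_commute[of u w] by simp
  have \<sigma>: "0 \<le> \<sigma>"
    using u(2) by auto
  have bound: "2 \<le> s * (\<sigma>\<^sup>2 * (norm w)\<^sup>2)" if "0 < s" for s :: real
  proof -
    define t where "t = complex_of_real s * cnj a"
    have "(norm (y (u + t *\<^sub>C w)))\<^sup>2 \<le> (\<sigma> * norm (u + t *\<^sub>C w))\<^sup>2"
      by (intro power_mono max) simp
    also have "\<dots> = \<sigma>\<^sup>2 * (1 + (cmod t * norm w)\<^sup>2)"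
      by (simp add: norm_add_sq power_mult_distrib u uw norm_scaleC)
    also have "(cmod t * norm w)\<^sup>2 = s\<^sup>2 * (cmod a)\<^sup>2 * (norm w)\<^sup>2"
      by (simp add: t_def power_mult_distrib norm_mult)
    finally have le: "(norm (y (u + t *\<^sub>C w)))\<^sup>2 \<le> \<sigma>\<^sup>2 * (1 + s\<^sup>2 * (cmod a)\<^sup>2 * (norm w)\<^sup>2)" .
    have "cinner (y u) (t *\<^sub>C y w) = complex_of_real s * (a * cnj a)"
      using cinner_commute[of "y u" "y w"] by (simp add: a_def t_def mult_ac)
    then have re: "Re (cinner (y u) (t *\<^sub>C y w)) = s * (cmod a)\<^sup>2"
      by (simp add: complex_norm_square[symmetric] del: of_real_power)
    have "(norm (y (u + t *\<^sub>C w)))\<^sup>2 = \<sigma>\<^sup>2 + 2 * (s * (cmod a)\<^sup>2) + (norm (t *\<^sub>C y w))\<^sup>2"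
      unfolding blinfun.add_right B_ell2_scaleC[OF y] norm_add_sq re u(2) ..
    moreover have "0 \<le> (norm (t *\<^sub>C y w))\<^sup>2"
      by simp
    ultimately have "2 * (s * (cmod a)\<^sup>2) \<le> \<sigma>\<^sup>2 * (s\<^sup>2 * (cmod a)\<^sup>2 * (norm w)\<^sup>2)"
      using le by (simp only: distrib_left mult_1_right)
    then have "(s * (cmod a)\<^sup>2) * 2 \<le> (s * (cmod a)\<^sup>2) * (s * (\<sigma>\<^sup>2 * (norm w)\<^sup>2))"
      by (simp add: power2_eq_square mult_ac)
    then show ?thesis
      using that a by (simp only: mult_le_cancel_left_pos mult_pos_pos)
  qed
  have nonneg: "0 \<le> \<sigma>\<^sup>2 * (norm w)\<^sup>2"
    by simp
  define s where "s = 1 / (\<sigma>\<^sup>2 * (norm w)\<^sup>2 + 1)"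
  have "0 < \<sigma>\<^sup>2 * (norm w)\<^sup>2 + 1"
    using nonneg by linarith
  then have "0 < s" "s * (\<sigma>\<^sup>2 * (norm w)\<^sup>2) \<le> 1"
    by (simp_all add: s_def divide_le_eq)
  with bound[of s] show False
    by simp
qed

text \<open>An orthonormal family in the coordinate subspace of \<open>F\<close> has at most \<open>card F\<close> members, which
  bounds the number of steps of the decomposition.\<close>

lemma orthonormal_card_le:
  assumes "orthonormal {..<k} u" "finite F" "\<And>l. l < k \<Longrightarrow> proj F (u l) = u l"
  shows "k \<le> card F"
proof -
  have on: "orthonormal F unit_vec"
    by (simp add: orthonormal_def)
  have "real k = (\<Sum>l<k. (norm (u l))\<^sup>2)"
    using assms(1) by (simp add: norm_orthonormal)
  also have "\<dots> = (\<Sum>l<k. \<Sum>i\<in>F. (cmod (coord (u l) i))\<^sup>2)"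
  proof (rule sum.cong)
    fix l assume "l \<in> {..<k}"
    then have "u l = (\<Sum>i\<in>F. coord (u l) i *\<^sub>C unit_vec i)"
      using assms(2,3) by (metis proj_finite lessThan_iff)
    then show "(norm (u l))\<^sup>2 = (\<Sum>i\<in>F. (cmod (coord (u l) i))\<^sup>2)"
      using norm_comb_orthonormal[OF on assms(2), of "coord (u l)"] by simp
  qed simp
  also have "\<dots> = (\<Sum>i\<in>F. \<Sum>l<k. (cmod (cinner (unit_vec i) (u l)))\<^sup>2)"
    by (subst sum.swap) (simp add: cinner_unit_vec_left)
  also have "\<dots> \<le> (\<Sum>i\<in>F. (norm (unit_vec i))\<^sup>2)"
    by (intro sum_mono bessel assms) simp
  also have "\<dots> = card F"
    by simp
  finally show ?thesis
    by simp
qed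

text \<open>The first \<open>k\<close> steps of a singular value decomposition of \<open>y\<close> on the coordinate subspace
  given by \<open>F\<close>: the singular values \<open>\<sigma>\<close> are positive and non-increasing, they bound \<open>y\<close> on the
  orthogonal complement of the \<open>u l\<close>, and \<open>y\<close> maps this complement into that of the \<open>v l\<close>.\<close>

definition partial_svd ::
  "oper \<Rightarrow> nat set \<Rightarrow> nat \<Rightarrow> (nat \<Rightarrow> ell2) \<Rightarrow> (nat \<Rightarrow> ell2) \<Rightarrow> (nat \<Rightarrow> real) \<Rightarrow> bool" where
  "partial_svd y F k u v \<sigma> \<longleftrightarrow>
     orthonormal {..<k} u \<and> orthonormal {..<k} v \<and>
     (\<forall>l<k. proj F (u l) = u l \<and> 0 < \<sigma> l \<and> y (u l) = complex_of_real (\<sigma> l) *\<^sub>C v l) \<and>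
     (\<forall>l<k. \<forall>j\<le>l. \<sigma> l \<le> \<sigma> j) \<and>
     (\<forall>w. proj F w = w \<longrightarrow> (\<forall>l<k. cinner w (u l) = 0) \<longrightarrow>
        (\<forall>l<k. norm (y w) \<le> \<sigma> l * norm w \<and> cinner (y w) (v l) = 0))"

text \<open>As long as \<open>y\<close> does not vanish on the complement of the \<open>u l\<close>, a unit vector of the complement
  at which its norm is attained yields the next step.\<close>

lemma partial_svd_extend:
  assumes y: "y \<in> B_ell2" and F: "finite F" and svd: "partial_svd y F k u v \<sigma>"
    and w0: "proj F w0 = w0" "\<And>l. l < k \<Longrightarrow> cinner w0 (u l) = 0" "y w0 \<noteq> 0"
  shows "\<exists>u v \<sigma>. partial_svd y F (Suc k) u v \<sigma>"
proof -
  have on: "orthonormal {..<k} u" "orthonormal {..<k} v"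
    and step: "\<And>l. l < k \<Longrightarrow> proj F (u l) = u l" "\<And>l. l < k \<Longrightarrow> 0 < \<sigma> l"
      "\<And>l. l < k \<Longrightarrow> y (u l) = complex_of_real (\<sigma> l) *\<^sub>C v l"
    and anti: "\<And>l j. l < k \<Longrightarrow> j \<le> l \<Longrightarrow> \<sigma> l \<le> \<sigma> j"
    and compl: "\<And>w l. proj F w = w \<Longrightarrow> (\<And>l. l < k \<Longrightarrow> cinner w (u l) = 0) \<Longrightarrow> l < k \<Longrightarrow>
      norm (y w) \<le> \<sigma> l * norm w \<and> cinner (y w) (v l) = 0"
    using svd unfolding partial_svd_def by blast+
  define V where "V = {w. proj F w = w \<and> (\<forall>l<k. cinner w (u l) = 0)}"
  have V_add: "a + c *\<^sub>C b \<in> V" if "a \<in> V" "b \<in> V" for a b c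
    using that by (auto simp: V_def blinfun.add_right B_ell2_scaleC cinner_add_left)
  have V_scale: "c *\<^sub>C b \<in> V" if "b \<in> V" for b c
    using that by (auto simp: V_def B_ell2_scaleC)
  define S where "S = {w \<in> V. norm w = 1}"
  have "S = {w. proj F w = w \<and> (\<forall>i. cmod (coord w i) \<le> 1)} \<inter>
      ({w. norm w = 1} \<inter> (\<Inter>l\<in>{..<k}. {w. cinner w (u l) = 0}))"
    unfolding S_def V_def by (auto intro: order_trans[OF cmod_coord_le])
  moreover have "closed ({w. norm w = 1} \<inter> (\<Inter>l\<in>{..<k}. {w. cinner w (u l) = 0}))"
    by (intro closed_Int closed_INT ballI closed_Collect_eq continuous_on_norm
        continuous_on_id continuous_on_const linear_continuous_on bounded_linear_cinner_left)
  ultimately have "compact S"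
    using compact_finite_support_box[OF F] by (simp add: compact_Int_closed)
  moreover have normalize: "complex_of_real (inverse (norm w)) *\<^sub>C w \<in> S" if "w \<in> V" "w \<noteq> 0" for w
    using that V_scale by (simp add: S_def norm_scaleC norm_inverse)
  have "w0 \<in> V" "w0 \<noteq> 0"
    using w0 by (auto simp: V_def)
  then have "S \<noteq> {}"
    using normalize by blast
  moreover have "continuous_on S (\<lambda>w. norm (y w))"
    by (intro continuous_intros)
  ultimately obtain u' where u': "u' \<in> S" and max: "\<And>w. w \<in> S \<Longrightarrow> norm (y w) \<le> norm (y u')"
    using continuous_attains_sup by metis
  define \<sigma>' where "\<sigma>' = norm (y u')"
  have bound: "norm (y w) \<le> \<sigma>' * norm w" if "w \<in> V" for w
  proof (cases "w = 0")
    case False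
    have "norm (y (complex_of_real (inverse (norm w)) *\<^sub>C w)) \<le> \<sigma>'"
      unfolding \<sigma>'_def using that False by (intro max normalize)
    then show ?thesis
      using False by (simp add: B_ell2_scaleC[OF y] norm_scaleC norm_inverse)
        (simp add: field_simps)
  qed simp
  have "0 < \<sigma>'"
  proof -
    have "0 < norm (y w0)"
      using w0 by simp
    also have "\<dots> \<le> \<sigma>' * norm w0"
      using \<open>w0 \<in> V\<close> by (rule bound)
    finally show ?thesis
      using \<open>w0 \<noteq> 0\<close> by (simp add: zero_less_mult_iff)
  qed
  have u'V: "u' \<in> V" and nu': "norm u' = 1"
    using u' by (auto simp: S_def)
  define v' where "v' = complex_of_real (inverse \<sigma>') *\<^sub>C y u'"
  have nv': "norm v' = 1"
    using \<open>0 < \<sigma>'\<close> by (simp add: v'_def norm_scaleC norm_inverse flip: \<sigma>'_def)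
  have uu': "cinner u' (u l) = 0" "cinner (u l) u' = 0" if "l < k" for l
    using that u'V cinner_commute[of "u l" u'] by (auto simp: V_def)
  have vv': "cinner v' (v l) = 0" "cinner (v l) v' = 0" if "l < k" for l
    using that u'V compl[of u' l] cinner_commute[of "v l" "y u'"] by (auto simp: V_def v'_def)
  have orth: "cinner (y w) v' = 0" if "w \<in> V" "cinner w u' = 0" for w
  proof -
    have "cinner (y w) (y u') = 0"
      by (rule cinner_image_eq_zero_of_maximal[OF y nu' \<sigma>'_def[symmetric]])
        (use that u'V bound V_add in auto)
    then show ?thesis
      by (simp add: v'_def)
  qed
  have "partial_svd y F (Suc k) (u(k := u')) (v(k := v')) (\<sigma>(k := \<sigma>'))"
    unfolding partial_svd_def
  proof (intro conjI allI impI)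
    show "orthonormal {..<Suc k} (u(k := u'))"
      using on(1) uu' cinner_self[of u'] nu' by (auto simp: orthonormal_def less_Suc_eq)
    show "orthonormal {..<Suc k} (v(k := v'))"
      using on(2) vv' cinner_self[of v'] nv' by (auto simp: orthonormal_def less_Suc_eq)
    fix l assume l: "l < Suc k"
    show "proj F ((u(k := u')) l) = (u(k := u')) l"
      using l step u'V by (auto simp: less_Suc_eq V_def)
    show "0 < (\<sigma>(k := \<sigma>')) l"
      using l step \<open>0 < \<sigma>'\<close> by (auto simp: less_Suc_eq)
    show "y ((u(k := u')) l) = complex_of_real ((\<sigma>(k := \<sigma>')) l) *\<^sub>C (v(k := v')) l"
      using l step \<open>0 < \<sigma>'\<close> by (auto simp: less_Suc_eq v'_def)
  next
    fix l j assume l: "l < Suc k" "j \<le> l"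
    have "\<sigma>' \<le> \<sigma> j" if "j < k"
      using that compl[of u' j] u'V nu' by (simp add: V_def \<sigma>'_def)
    then show "(\<sigma>(k := \<sigma>')) l \<le> (\<sigma>(k := \<sigma>')) j"
      using l anti by (auto simp: less_Suc_eq)
  next
    fix w l assume w: "proj F w = w" "\<forall>l<Suc k. cinner w ((u(k := u')) l) = 0" and l: "l < Suc k"
    have wl: "cinner w (u l) = 0" if "l < k" for l
      using w(2) that by (metis fun_upd_other less_SucI nat_neq_iff)
    have wu': "cinner w u' = 0"
      using w(2) by auto
    have "w \<in> V"
      using w(1) wl by (simp add: V_def)
    then show "norm (y w) \<le> (\<sigma>(k := \<sigma>')) l * norm w" "cinner (y w) ((v(k := v')) l) = 0"
      using l wl bound orth wu' compl[of w l] w(1) by (auto simp: less_Suc_eq)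
  qed
  then show ?thesis
    by blast
qed

theorem singular_value_decomposition:
  assumes x: "x \<in> B_ell2" and F: "finite F"
  obtains k :: nat and u v :: "nat \<Rightarrow> ell2" and \<sigma> :: "nat \<Rightarrow> real" where "orthonormal {..<k} u" "orthonormal {..<k} v"
    "\<And>l. l < k \<Longrightarrow> proj F (u l) = u l" "\<And>l. l < k \<Longrightarrow> proj F (v l) = v l"
    "\<And>l. l < k \<Longrightarrow> 0 < \<sigma> l" "\<And>l j. l < k \<Longrightarrow> j \<le> l \<Longrightarrow> \<sigma> l \<le> \<sigma> j"
    "\<And>w. (proj F o\<^sub>L x o\<^sub>L proj F) w = (\<Sum>l<k. (complex_of_real (\<sigma> l) * cinner w (u l)) *\<^sub>C v l)"
proof -
  define y where "y = proj F o\<^sub>L x o\<^sub>L proj F"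
  have y: "y \<in> B_ell2"
    unfolding y_def using x by (intro B_ell2_compose) auto
  define P where "P k \<longleftrightarrow> (\<exists>u v \<sigma>. partial_svd y F k u v \<sigma>)" for k
  have "P 0"
    unfolding P_def partial_svd_def by (simp add: orthonormal_def)
  moreover have "k \<le> card F" if Pk: "P k" for k
  proof -
    obtain u v \<sigma> where "partial_svd y F k u v \<sigma>"
      using Pk unfolding P_def by blast
    then show ?thesis
      unfolding partial_svd_def by (intro orthonormal_card_le[OF _ F]) auto
  qed
  ultimately obtain k where "P k" and "\<not> P (Suc k)"
    by (metis Suc_n_not_le_n GreatestI_nat Greatest_le_nat)
  then obtain u v \<sigma> where svd: "partial_svd y F k u v \<sigma>"
    unfolding P_def by blast
  then have on: "orthonormal {..<k} u" "orthonormal {..<k} v"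
    and step: "\<And>l. l < k \<Longrightarrow> proj F (u l) = u l" "\<And>l. l < k \<Longrightarrow> 0 < \<sigma> l"
      "\<And>l. l < k \<Longrightarrow> y (u l) = complex_of_real (\<sigma> l) *\<^sub>C v l"
    and anti: "\<And>l j. l < k \<Longrightarrow> j \<le> l \<Longrightarrow> \<sigma> l \<le> \<sigma> j"
    unfolding partial_svd_def by blast+
  have vanish: "y w = 0" if "proj F w = w" "\<And>l. l < k \<Longrightarrow> cinner w (u l) = 0" for w
    using partial_svd_extend[OF y F svd, of w] that \<open>\<not> P (Suc k)\<close> unfolding P_def by blast
  have "y w = (\<Sum>l<k. (complex_of_real (\<sigma> l) * cinner w (u l)) *\<^sub>C v l)" for w
  proof -
    define w' where "w' = (\<Sum>l<k. cinner w (u l) *\<^sub>C u l)"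
    have pw': "proj F w' = w'"
      by (simp add: w'_def blinfun.sum_right B_ell2_scaleC step)
    have "cinner (proj F w - w') (u l) = 0" if "l < k" for l
      using cinner_comb_orthonormal[OF on(1), of l "\<lambda>l. cinner w (u l)"] that
      by (simp add: cinner_diff_left w'_def cinner_proj step)
    then have "y (proj F w - w') = 0"
      by (intro vanish) (auto simp: blinfun.diff_right pw')
    then have "y w = y w'"
      by (simp add: blinfun.diff_right y_def)
    then show ?thesis
      by (simp add: w'_def blinfun.sum_right B_ell2_scaleC y step mult_ac)
  qed
  moreover have "proj F (v l) = v l" if "l < k" for l
  proof -
    have "v l = complex_of_real (inverse (\<sigma> l)) *\<^sub>C y (u l)"
      using step(2,3)[OF that] by simp
    then show ?thesis
      by (simp add: B_ell2_scaleC) (simp add: y_def)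
  qed
  ultimately show ?thesis
    using that[of k u v \<sigma>] on step anti unfolding y_def by blast
qed

text \<open>The numbers found in the decomposition of a finite section of \<open>x\<close> are at most the
  corresponding singular numbers of \<open>x\<close>: an operator \<open>f\<close> of rank at most \<open>m\<close> annihilates a nonzero
  combination of the first \<open>m + 1\<close> vectors \<open>u l\<close>.\<close>

lemma rank_le_kernel:
  fixes u :: "nat \<Rightarrow> ell2"
  assumes f: "f \<in> B_ell2" "rank_le m f"
  obtains c :: "nat \<Rightarrow> complex" and l where "l \<le> m" "c l \<noteq> 0" "f (\<Sum>l\<le>m. c l *\<^sub>C u l) = 0"
proof (cases "inj_on (\<lambda>l. f (u l)) {..m}")
  case False
  then obtain a b where ab: "a \<le> m" "b \<le> m" "a \<noteq> b" "f (u a) = f (u b)"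
    by (auto simp: inj_on_def)
  define c :: "nat \<Rightarrow> complex" where "c l = (if l = a then 1 else if l = b then - 1 else 0)" for l
  have "(\<Sum>l\<le>m. c l *\<^sub>C u l) = (\<Sum>l\<in>{a, b}. c l *\<^sub>C u l)"
    by (rule sum.mono_neutral_right) (use ab in \<open>auto simp: c_def\<close>)
  also have "\<dots> = u a - u b"
    using ab by (simp add: c_def)
  finally have "f (\<Sum>l\<le>m. c l *\<^sub>C u l) = 0"
    using ab by (simp add: blinfun.diff_right)
  then show ?thesis
    using ab by (intro that[of a c]) (auto simp: c_def)
next
  case True
  obtain B where B: "finite B" "card B \<le> m" "range f \<subseteq> ell2.span B"
    using f(2) unfolding rank_le_def by blast
  let ?S = "(\<lambda>l. f (u l)) ` {..m}"
  have "card ?S = Suc m"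
    using True by (simp add: card_image)
  moreover have "?S \<subseteq> ell2.span B"
    using B by auto
  ultimately have "ell2.dependent ?S"
    using ell2.independent_span_bound[OF B(1), of ?S] B(2) by auto
  then obtain d x where d: "x \<in> ?S" "d x \<noteq> 0" "(\<Sum>x\<in>?S. d x *\<^sub>C x) = 0"
    using ell2.dependent_finite[of ?S] by auto
  define c where "c l = d (f (u l))" for l
  have "f (\<Sum>l\<le>m. c l *\<^sub>C u l) = (\<Sum>x\<in>?S. d x *\<^sub>C x)"
    by (subst sum.reindex[OF True]) (simp add: blinfun.sum_right B_ell2_scaleC f c_def)
  then show ?thesis
    using d that unfolding c_def by auto
qed

lemma singular_value_le_singular_number:
  assumes x: "x \<in> B_ell2" and on: "orthonormal {..<k} u" "orthonormal {..<k} v"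
    and supp: "\<And>l. l < k \<Longrightarrow> proj F (u l) = u l"
    and pos: "\<And>l. l < k \<Longrightarrow> 0 < \<sigma> l" and anti: "\<And>l j. l < k \<Longrightarrow> j \<le> l \<Longrightarrow> \<sigma> l \<le> \<sigma> j"
    and svd: "\<And>w. (proj F o\<^sub>L x o\<^sub>L proj F) w = (\<Sum>l<k. (complex_of_real (\<sigma> l) * cinner w (u l)) *\<^sub>C v l)"
    and m: "m < k"
  shows "\<sigma> m \<le> singular_number x m"
proof (rule singular_number_ge)
  fix f assume f: "f \<in> B_ell2" "rank_le m f"
  obtain c l0 where c: "l0 \<le> m" "c l0 \<noteq> 0" "f (\<Sum>l\<le>m. c l *\<^sub>C u l) = 0"
    using rank_le_kernel[OF f] .
  define w where "w = (\<Sum>l\<le>m. c l *\<^sub>C u l)"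
  have on': "orthonormal {..m} u" "orthonormal {..m} v"
    using on m by (auto simp: orthonormal_def)
  have nw: "(norm w)\<^sup>2 = (\<Sum>l\<le>m. (cmod (c l))\<^sup>2)"
    unfolding w_def by (rule norm_comb_orthonormal[OF on'(1)]) simp
  have "0 < (cmod (c l0))\<^sup>2"
    using c by simp
  also have "\<dots> \<le> (norm w)\<^sup>2"
    unfolding nw using c(1) by (intro member_le_sum) auto
  finally have "0 < norm w"
    by (simp add: zero_less_power2)
  have pw: "proj F w = w"
    using m by (simp add: w_def blinfun.sum_right B_ell2_scaleC supp)
  have wu: "cinner w (u l) = (if l \<le> m then c l else 0)" if "l < k" for l
  proof (cases "l \<le> m")
    case True
    then show ?thesis
      unfolding w_def using cinner_comb_orthonormal[OF on'(1)] by simp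
  next
    case False
    then show ?thesis
      unfolding w_def cinner_sum_left using on(1) m that
      by (auto intro!: sum.neutral simp: orthonormal_def)
  qed
  have "(proj F o\<^sub>L x o\<^sub>L proj F) w = (\<Sum>l\<in>{..<k}. (complex_of_real (\<sigma> l) * cinner w (u l)) *\<^sub>C v l)"
    by (rule svd)
  also have "\<dots> = (\<Sum>l\<le>m. (complex_of_real (\<sigma> l) * c l) *\<^sub>C v l)"
    by (rule sum.mono_neutral_cong_right) (use m wu in auto)
  finally have "(norm ((proj F o\<^sub>L x o\<^sub>L proj F) w))\<^sup>2 = (\<Sum>l\<le>m. (cmod (complex_of_real (\<sigma> l) * c l))\<^sup>2)"
    using norm_comb_orthonormal[OF on'(2), of "\<lambda>l. complex_of_real (\<sigma> l) * c l"] by simp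
  also have "\<dots> \<ge> (\<Sum>l\<le>m. (\<sigma> m)\<^sup>2 * (cmod (c l))\<^sup>2)"
  proof (rule sum_mono)
    fix l assume "l \<in> {..m}"
    then have "(\<sigma> m)\<^sup>2 \<le> (\<sigma> l)\<^sup>2"
      using m anti pos[OF m] by (intro power_mono) auto
    then show "(\<sigma> m)\<^sup>2 * (cmod (c l))\<^sup>2 \<le> (cmod (complex_of_real (\<sigma> l) * c l))\<^sup>2"
      by (simp add: norm_mult power_mult_distrib mult_right_mono)
  qed
  finally have "(\<sigma> m * norm w)\<^sup>2 \<le> (norm ((proj F o\<^sub>L x o\<^sub>L proj F) w))\<^sup>2"
    by (simp add: nw power_mult_distrib sum_distrib_left)
  then have "\<sigma> m * norm w \<le> norm ((proj F o\<^sub>L x o\<^sub>L proj F) w)"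
    by (rule power2_le_imp_le) simp
  also have "\<dots> \<le> norm (x w)"
    using norm_proj_apply_le[of F "x w"] by (simp add: pw)
  also have "\<dots> = norm ((x - f) w)"
    using c(3) by (simp add: blinfun.diff_left w_def)
  also have "\<dots> \<le> norm (x - f) * norm w"
    by (rule norm_blinfun)
  finally show "\<sigma> m \<le> norm (x - f)"
    using \<open>0 < norm w\<close> by simp
qed


section \<open>Trace duality\<close>

text \<open>Ky Fan's inequality: the trace norm bounds the sums \<open>\<Sum>\<bar>\<langle>x a\<^sub>i, b\<^sub>i\<rangle>\<bar>\<close> over finite orthonormal families.
  Expand a finite section of \<open>x\<close> by its singular value decomposition and apply Bessel's inequality
  to each term.\<close>

lemma sum_cinner_le_trace_norm:
  assumes x: "x \<in> B_ell2" "summable (singular_number x)"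
    and I: "finite I" "orthonormal I a" "orthonormal I b"
    and F: "finite F" "\<And>i. i \<in> I \<Longrightarrow> proj F (a i) = a i" "\<And>i. i \<in> I \<Longrightarrow> proj F (b i) = b i"
  shows "(\<Sum>i\<in>I. cmod (cinner (x (a i)) (b i))) \<le> (\<Sum>n. singular_number x n)"
proof -
  obtain k :: nat and u v :: "nat \<Rightarrow> ell2" and \<sigma> where on: "orthonormal {..<k} u" "orthonormal {..<k} v"
    and supp: "\<And>l. l < k \<Longrightarrow> proj F (u l) = u l" "\<And>l. l < k \<Longrightarrow> proj F (v l) = v l"
    and pos: "\<And>l. l < k \<Longrightarrow> 0 < \<sigma> l" and anti: "\<And>l j. l < k \<Longrightarrow> j \<le> l \<Longrightarrow> \<sigma> l \<le> \<sigma> j"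
    and svd: "\<And>w. (proj F o\<^sub>L x o\<^sub>L proj F) w = (\<Sum>l<k. (complex_of_real (\<sigma> l) * cinner w (u l)) *\<^sub>C v l)"
    by (rule singular_value_decomposition[OF x(1) F(1)]) blast
  have "cmod (cinner (x (a i)) (b i)) \<le>
      (\<Sum>l<k. \<sigma> l * (cmod (cinner (a i) (u l)) * cmod (cinner (v l) (b i))))" if "i \<in> I" for i
  proof -
    have "cinner (x (a i)) (b i) = cinner ((proj F o\<^sub>L x o\<^sub>L proj F) (a i)) (b i)"
      using that by (simp add: cinner_proj F)
    also have "\<dots> = (\<Sum>l<k. complex_of_real (\<sigma> l) * cinner (a i) (u l) * cinner (v l) (b i))"
      unfolding svd by (simp add: cinner_sum_left)
    finally show ?thesis
      using pos by (auto intro!: order_trans[OF norm_sum] sum_mono simp: norm_mult less_imp_le)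
  qed
  then have "(\<Sum>i\<in>I. cmod (cinner (x (a i)) (b i))) \<le>
      (\<Sum>i\<in>I. \<Sum>l<k. \<sigma> l * (cmod (cinner (a i) (u l)) * cmod (cinner (v l) (b i))))"
    by (rule sum_mono)
  also have "\<dots> = (\<Sum>l<k. \<sigma> l * (\<Sum>i\<in>I. cmod (cinner (a i) (u l)) * cmod (cinner (v l) (b i))))"
    by (subst sum.swap) (simp add: sum_distrib_left)
  also have "\<dots> \<le> (\<Sum>l<k. \<sigma> l * 1)"
  proof (intro sum_mono mult_left_mono)
    fix l assume l: "l \<in> {..<k}"
    have "(\<Sum>i\<in>I. cmod (cinner (a i) (u l)) * cmod (cinner (v l) (b i))) \<le>
        (\<Sum>i\<in>I. ((cmod (cinner (a i) (u l)))\<^sup>2 + (cmod (cinner (v l) (b i)))\<^sup>2) / 2)"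
    proof (rule sum_mono)
      fix i
      show "cmod (cinner (a i) (u l)) * cmod (cinner (v l) (b i)) \<le>
          ((cmod (cinner (a i) (u l)))\<^sup>2 + (cmod (cinner (v l) (b i)))\<^sup>2) / 2"
        using sum_squares_bound[of "cmod (cinner (a i) (u l))" "cmod (cinner (v l) (b i))"] by simp
    qed
    also have "\<dots> = ((\<Sum>i\<in>I. (cmod (cinner (a i) (u l)))\<^sup>2) + (\<Sum>i\<in>I. (cmod (cinner (v l) (b i)))\<^sup>2)) / 2"
      by (simp add: sum.distrib flip: sum_divide_distrib)
    also have "\<dots> \<le> ((norm (u l))\<^sup>2 + (norm (v l))\<^sup>2) / 2"
      using bessel_left[OF I(2,1), of "u l"] bessel[OF I(3,1), of "v l"] by simp
    also have "\<dots> = 1"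
      using l norm_orthonormal[OF on(1)] norm_orthonormal[OF on(2)] by simp
    finally show "(\<Sum>i\<in>I. cmod (cinner (a i) (u l)) * cmod (cinner (v l) (b i))) \<le> 1" .
  qed (use pos in \<open>auto intro: less_imp_le\<close>)
  also have "\<dots> \<le> (\<Sum>l<k. singular_number x l)"
    using singular_value_le_singular_number[OF x(1) on supp(1) pos anti svd]
    by (intro sum_mono) auto
  also have "\<dots> \<le> (\<Sum>n. singular_number x n)"
    using x(2) by (intro sum_le_suminf) (auto intro: singular_number_nonneg)
  finally show ?thesis .
qed

text \<open>Conversely, some such sum is at least the trace norm of a finite section, and hence equal to it.\<close>

lemma trace_norm_section_attained:
  assumes x: "x \<in> B_ell2" and F: "finite F"
  obtains k :: nat and u v :: "nat \<Rightarrow> ell2" where "orthonormal {..<k} u" "orthonormal {..<k} v"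
    "\<And>l. l < k \<Longrightarrow> proj F (u l) = u l" "\<And>l. l < k \<Longrightarrow> proj F (v l) = v l"
    "\<And>K. (\<Sum>n<K. singular_number (proj F o\<^sub>L x o\<^sub>L proj F) n)
      \<le> cmod (\<Sum>l<k. cinner (x (u l)) (v l))"
proof -
  define y where "y = proj F o\<^sub>L x o\<^sub>L proj F"
  obtain k :: nat and u v :: "nat \<Rightarrow> ell2" and \<sigma> where on: "orthonormal {..<k} u" "orthonormal {..<k} v"
    and supp: "\<And>l. l < k \<Longrightarrow> proj F (u l) = u l" "\<And>l. l < k \<Longrightarrow> proj F (v l) = v l"
    and pos: "\<And>l. l < k \<Longrightarrow> 0 < \<sigma> l" and anti: "\<And>l j. l < k \<Longrightarrow> j \<le> l \<Longrightarrow> \<sigma> l \<le> \<sigma> j"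
    and svd: "\<And>w. y w = (\<Sum>l<k. (complex_of_real (\<sigma> l) * cinner w (u l)) *\<^sub>C v l)"
    unfolding y_def by (rule singular_value_decomposition[OF x F]) blast
  have s_le: "singular_number y n \<le> (if n < k then \<sigma> n else 0)" for n
  proof -
    define f where "f = (\<Sum>l<min n k. rank_one (complex_of_real (\<sigma> l) *\<^sub>C v l) (u l))"
    have "f \<in> B_ell2"
      unfolding f_def by (intro B_ell2_sum) simp
    moreover have "rank_le n f"
      unfolding f_def by (rule rank_le_mono[OF rank_le_sum_rank_one]) auto
    ultimately have "singular_number y n \<le> norm (y - f)"
      by (rule singular_number_le)
    also have "\<dots> \<le> (if n < k then \<sigma> n else 0)"
    proof (rule norm_blinfun_bound)
      show "0 \<le> (if n < k then \<sigma> n else 0)"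
        using pos by (auto intro: less_imp_le)
      fix w
      have "(y - f) w = (\<Sum>l<k. (complex_of_real (\<sigma> l) * cinner w (u l)) *\<^sub>C v l)
          - (\<Sum>l<min n k. (complex_of_real (\<sigma> l) * cinner w (u l)) *\<^sub>C v l)"
        by (simp add: blinfun.diff_left svd f_def blinfun.sum_left mult.commute)
      also have "\<dots> = (\<Sum>l\<in>{..<k} - {..<min n k}. (complex_of_real (\<sigma> l) * cinner w (u l)) *\<^sub>C v l)"
        by (rule sum_diff[symmetric]) auto
      also have "{..<k} - {..<min n k} = {n..<k}"
        by auto
      finally have eq: "(y - f) w = (\<Sum>l\<in>{n..<k}. (complex_of_real (\<sigma> l) * cinner w (u l)) *\<^sub>C v l)" .
      show "norm ((y - f) w) \<le> (if n < k then \<sigma> n else 0) * norm w"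
      proof (cases "n < k")
        case True
        have on': "orthonormal {n..<k} u" "orthonormal {n..<k} v"
          using on by (auto simp: orthonormal_def)
        have "(norm ((y - f) w))\<^sup>2 = (\<Sum>l\<in>{n..<k}. (cmod (complex_of_real (\<sigma> l) * cinner w (u l)))\<^sup>2)"
          unfolding eq by (rule norm_comb_orthonormal[OF on'(2)]) simp
        also have "\<dots> \<le> (\<Sum>l\<in>{n..<k}. (\<sigma> n)\<^sup>2 * (cmod (cinner w (u l)))\<^sup>2)"
        proof (rule sum_mono)
          fix l assume "l \<in> {n..<k}"
          then have "(\<sigma> l)\<^sup>2 \<le> (\<sigma> n)\<^sup>2"
            using anti pos[of l] by (intro power_mono) auto
          then show "(cmod (complex_of_real (\<sigma> l) * cinner w (u l)))\<^sup>2 \<le> (\<sigma> n)\<^sup>2 * (cmod (cinner w (u l)))\<^sup>2"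
            by (simp add: norm_mult power_mult_distrib mult_right_mono)
        qed
        also have "\<dots> \<le> (\<sigma> n)\<^sup>2 * (norm w)\<^sup>2"
          unfolding sum_distrib_left[symmetric]
          by (intro mult_left_mono bessel on') auto
        finally have "(norm ((y - f) w))\<^sup>2 \<le> (\<sigma> n * norm w)\<^sup>2"
          by (simp add: power_mult_distrib)
        then show ?thesis
          using True pos[OF True] by (simp add: power2_le_iff_abs_le abs_of_pos)
      next
        case False
        then show ?thesis
          unfolding eq by simp
      qed
    qed
    finally show ?thesis .
  qed
  have "(\<Sum>n<K. singular_number y n) \<le> cmod (\<Sum>l<k. cinner (x (u l)) (v l))" for K
  proof -
    have "(\<Sum>n<K. singular_number y n) \<le> (\<Sum>n<K. if n < k then \<sigma> n else 0)"
      by (intro sum_mono s_le)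
    also have "\<dots> \<le> (\<Sum>n<max K k. if n < k then \<sigma> n else 0)"
      using pos by (intro sum_mono2) (auto intro: less_imp_le)
    also have "\<dots> = (\<Sum>l<k. \<sigma> l)"
      by (rule sum.mono_neutral_cong_right) auto
    finally have le: "(\<Sum>n<K. singular_number y n) \<le> (\<Sum>l<k. \<sigma> l)" .
    have "cinner (x (u l)) (v l) = complex_of_real (\<sigma> l)" if "l < k" for l
    proof -
      have "cinner (x (u l)) (v l) = cinner (y (u l)) (v l)"
        using that by (simp add: y_def cinner_proj supp)
      also have "\<dots> = complex_of_real (\<sigma> l) * cinner (u l) (u l)"
        unfolding svd using that by (intro cinner_comb_orthonormal[OF on(2)]) auto
      finally show ?thesis
        using on(1) that by (simp add: orthonormal_def)
    qed
    then have "(\<Sum>l<k. cinner (x (u l)) (v l)) = complex_of_real (\<Sum>l<k. \<sigma> l)"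
      by simp
    then have "cmod (\<Sum>l<k. cinner (x (u l)) (v l)) = \<bar>\<Sum>l<k. \<sigma> l\<bar>"
      by (metis norm_of_real real_norm_def)
    then show ?thesis
      using le by linarith
  qed
  then show ?thesis
    using that[of k u v] on supp unfolding y_def by blast
qed


section \<open>Trace class operators\<close>

lemma schatten_l1_iff: "x \<in> schatten l1 \<longleftrightarrow> x \<in> B_ell2 \<and> summable (singular_number x)"
  by (simp add: schatten_def l1_def singular_number_nonneg)

lemma trace_norm_eq: "schatten_norm l1_norm x = (\<Sum>n. singular_number x n)"
  by (simp add: schatten_norm_def l1_norm_def singular_number_nonneg)

lemma trace_norm_nonneg: "x \<in> schatten l1 \<Longrightarrow> 0 \<le> schatten_norm l1_norm x"
  by (simp add: trace_norm_eq schatten_l1_iff suminf_nonneg singular_number_nonneg)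

lemma norm_le_trace_norm: "x \<in> schatten l1 \<Longrightarrow> norm x \<le> schatten_norm l1_norm x"
  using sum_le_suminf[of "singular_number x" "{0}"]
  by (simp add: trace_norm_eq schatten_l1_iff singular_number_nonneg singular_number_0)

lemma compose_contractions_schatten_l1:
  assumes "x \<in> schatten l1" "a \<in> B_ell2" "norm a \<le> 1" "b \<in> B_ell2" "norm b \<le> 1"
  shows "a o\<^sub>L x o\<^sub>L b \<in> schatten l1"
    and "schatten_norm l1_norm (a o\<^sub>L x o\<^sub>L b) \<le> schatten_norm l1_norm x"
proof -
  note le = singular_number_compose_le[OF assms(2-5), of x]
  have x: "x \<in> B_ell2" "summable (singular_number x)"
    using assms(1) by (simp_all add: schatten_l1_iff)
  then have s: "summable (singular_number (a o\<^sub>L x o\<^sub>L b))"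
    by (intro summable_comparison_test'[OF x(2), where N = 0])
      (simp add: le singular_number_nonneg)
  then show "a o\<^sub>L x o\<^sub>L b \<in> schatten l1"
    using assms x by (simp add: schatten_l1_iff B_ell2_compose)
  show "schatten_norm l1_norm (a o\<^sub>L x o\<^sub>L b) \<le> schatten_norm l1_norm x"
    unfolding trace_norm_eq by (intro suminf_le le s x)
qed

lemma singular_number_rank_one:
  "singular_number (rank_one w z) = (\<lambda>n. if n = 0 then norm (rank_one w z) else 0)"
proof
  fix n
  have "singular_number (rank_one w z) n = 0" if "n \<noteq> 0"
    using that by (intro singular_number_rank_le rank_le_mono[OF rank_le_rank_one]) auto
  then show "singular_number (rank_one w z) n = (if n = 0 then norm (rank_one w z) else 0)"
    by (simp add: singular_number_0)
qed

lemma rank_one_schatten_l1: "rank_one w z \<in> schatten l1"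
  using summable_single[of 0 "\<lambda>_. norm (rank_one w z)"]
  by (simp add: schatten_l1_iff singular_number_rank_one)

lemma trace_norm_rank_one_le: "schatten_norm l1_norm (rank_one w z) \<le> norm w * norm z"
  using sums_unique[OF sums_single[of 0 "\<lambda>_. norm (rank_one w z)"]] norm_rank_one_le[of w z]
  by (simp add: trace_norm_eq singular_number_rank_one)

text \<open>For a single trace class operator the corners tend to zero in trace norm, by dominated
  convergence of the singular numbers.\<close>

lemma corner_trace_norm_tendsto:
  assumes "x \<in> schatten l1"
  shows "(\<lambda>a. schatten_norm l1_norm (proj {a..} o\<^sub>L x o\<^sub>L proj {a..})) \<longlonglongrightarrow> 0"
proof -
  have x: "x \<in> B_ell2" "summable (singular_number x)"
    using assms by (simp_all add: schatten_l1_iff)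
  define y where "y a = proj {a..} o\<^sub>L x o\<^sub>L proj {a..}" for a
  have "norm (y a) \<le> norm (x - (proj {..<a} o\<^sub>L x o\<^sub>L proj {..<a}))" for a
  proof -
    have "{..<a} \<inter> {a..} = {}" "{a..} \<inter> {..<a} = {}"
      by auto
    then have "proj ({..<a} \<inter> {a..}) v = 0" "proj ({a..} \<inter> {..<a}) v = 0" for v
      by (auto intro: coord_eqI)
    then have "y a = proj {a..} o\<^sub>L (x - (proj {..<a} o\<^sub>L x o\<^sub>L proj {..<a})) o\<^sub>L proj {a..}"
      by (intro blinfun_eqI) (simp add: y_def blinfun.diff_left blinfun.diff_right)
    then show ?thesis
      by (simp add: norm_compose_contractions_le norm_proj_le)
  qed
  then have lim: "(\<lambda>a. norm (y a)) \<longlonglongrightarrow> 0"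
    by (intro tendsto_sandwich[OF _ _ tendsto_const
          compact_truncation_tendsto[OF x(1) summable_LIMSEQ_zero[OF x(2)]]]) auto
  have "(\<lambda>a. singular_number (y a) n) \<longlonglongrightarrow> 0" for n
    by (rule tendsto_sandwich[OF _ _ tendsto_const lim])
      (auto simp: singular_number_nonneg singular_number_antimono[of 0 n]
        simp flip: singular_number_0)
  moreover have "\<forall>\<^sub>F (n, a) in sequentially \<times>\<^sub>F sequentially.
      norm (singular_number (y a) n) \<le> singular_number x n"
    by (intro always_eventually)
      (auto simp: y_def singular_number_nonneg singular_number_compose_le norm_proj_le)
  ultimately have "(\<lambda>a. \<Sum>n. singular_number (y a) n) \<longlonglongrightarrow> (\<Sum>n. 0)"
    using tannerys_theorem[of "\<lambda>n a. singular_number (y a) n" "\<lambda>_. 0" sequentially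
        "singular_number x"] x(2)
    by simp
  then show ?thesis
    by (simp add: trace_norm_eq y_def)
qed


section \<open>Weakly null sequences\<close>

lemma bounded_functional_cinner: "bounded_functional (\<lambda>x. cinner (x u) v)"
  unfolding bounded_functional_def
proof (intro conjI ballI allI exI)
  fix x assume x: "x \<in> schatten l1"
  have "cmod (cinner (x u) v) \<le> norm x * norm u * norm v"
    by (rule cinner_blinfun_le)
  also have "\<dots> \<le> schatten_norm l1_norm x * norm u * norm v"
    by (intro mult_right_mono norm_le_trace_norm x) auto
  finally show "cmod (cinner (x u) v) \<le> (norm u * norm v) * schatten_norm l1_norm x"
    by (simp add: mult_ac)
qed (auto simp: blinfun.add_left cinner_add_left scaleC_oper_apply)

lemma bounded_functional_add:
  assumes "bounded_functional f" "bounded_functional g"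
  shows "bounded_functional (\<lambda>x. f x + g x)"
proof -
  obtain C D where C: "\<And>x. x \<in> schatten l1 \<Longrightarrow> cmod (f x) \<le> C * schatten_norm l1_norm x"
    and D: "\<And>x. x \<in> schatten l1 \<Longrightarrow> cmod (g x) \<le> D * schatten_norm l1_norm x"
    using assms unfolding bounded_functional_def by blast
  have "cmod (f x + g x) \<le> (C + D) * schatten_norm l1_norm x" if "x \<in> schatten l1" for x
    using norm_triangle_ineq[of "f x" "g x"] C[OF that] D[OF that] by (simp add: distrib_right)
  then show ?thesis
    using assms unfolding bounded_functional_def by (auto simp: distrib_left)
qed

lemma bounded_functional_sum_cinner:
  "bounded_functional (\<lambda>x. \<Sum>l<(k::nat). cinner (x (u l)) (v l))"
proof (induction k)
  case 0
  show ?case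
    unfolding bounded_functional_def by (simp, rule exI[of _ 0], simp)
next
  case (Suc k)
  then show ?case
    by (simp add: bounded_functional_add bounded_functional_cinner)
qed

lemma bounded_functional_suminf:
  assumes t: "\<And>k. bounded_functional (t k)"
    and C: "\<And>x K. x \<in> schatten l1 \<Longrightarrow> (\<Sum>k<K. cmod (t k x)) \<le> C * schatten_norm l1_norm x"
  shows "bounded_functional (\<lambda>x. \<Sum>k. t k x)"
    and "\<And>x. x \<in> schatten l1 \<Longrightarrow> summable (\<lambda>k. cmod (t k x))"
proof -
  show abs: "summable (\<lambda>k. cmod (t k x))" if "x \<in> schatten l1" for x
    using C[OF that] by (intro summableI_nonneg_bounded) auto
  have s: "summable (\<lambda>k. t k x)" if "x \<in> schatten l1" for x
    by (rule summable_norm_cancel[OF abs[OF that]])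
  have "cmod (\<Sum>k. t k x) \<le> C * schatten_norm l1_norm x" if "x \<in> schatten l1" for x
    using summable_norm[OF abs[OF that]] suminf_le_const[OF abs[OF that] C[OF that]] by linarith
  moreover have "(\<Sum>k. t k (x + y)) = (\<Sum>k. t k x) + (\<Sum>k. t k y)"
    if "x \<in> schatten l1" "y \<in> schatten l1" for x y
    using t that suminf_add[OF s s] by (simp add: bounded_functional_def)
  moreover have "(\<Sum>k. t k (scaleC_oper c x)) = c * (\<Sum>k. t k x)" if "x \<in> schatten l1" for c x
    using t that suminf_mult[OF s] by (simp add: bounded_functional_def)
  ultimately show "bounded_functional (\<lambda>x. \<Sum>k. t k x)"
    unfolding bounded_functional_def by blast
qed

text \<open>The gliding hump. The predicate \<open>P a b t\<close> says that \<open>t\<close> is an admissible functional carried by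
  the block of indices from \<open>a\<close> to \<open>b\<close>. If admissible functionals on consecutive blocks can be
  summed, with small sums for blocks far out, then a weakly null sequence is eventually uniformly
  small on all admissible functionals far out. Otherwise one picks blocks and members of the
  sequence in turn, so that the \<open>k\<close>-th chosen member is large on the \<open>k\<close>-th functional and small on
  all the others; the sum of the functionals then does not tend to zero along the sequence.\<close>

lemma gliding_hump:
  fixes X :: "nat \<Rightarrow> oper" and P :: "nat \<Rightarrow> nat \<Rightarrow> (oper \<Rightarrow> complex) \<Rightarrow> bool"
  assumes X: "weakly_null X"
    and functional: "\<And>a b t. P a b t \<Longrightarrow> bounded_functional t"
    and mono: "\<And>a b c t. P a b t \<Longrightarrow> b \<le> c \<Longrightarrow> P a c t"
    and sum: "\<And>m t. strict_mono m \<Longrightarrow> (\<And>k. P (m k) (m (Suc k)) (t k)) \<Longrightarrow>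
      \<exists>C. \<forall>x\<in>schatten l1. \<forall>K. (\<Sum>k<K. cmod (t k x)) \<le> C * schatten_norm l1_norm x"
    and tail: "\<And>x e. x \<in> schatten l1 \<Longrightarrow> 0 < e \<Longrightarrow>
      \<exists>a. \<forall>m t. strict_mono m \<longrightarrow> a \<le> m 0 \<longrightarrow> (\<forall>k. P (m k) (m (Suc k)) (t k)) \<longrightarrow>
        (\<forall>K. (\<Sum>k<K. cmod (t k x)) \<le> e)"
    and e: "0 < e"
  shows "\<exists>a N. \<forall>n\<ge>N. \<forall>b>a. \<forall>t. P a b t \<longrightarrow> cmod (t (X n)) \<le> e"
proof (rule ccontr)
  assume "\<not> ?thesis"
  then have big: "\<exists>n\<ge>N. \<exists>b>a. \<exists>t. P a b t \<and> e < cmod (t (X n))" for a N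
    by (meson not_le)
  have XS: "X n \<in> schatten l1" for n
    using X by (simp add: weakly_null_def)
  define T where "T x a \<longleftrightarrow> (\<forall>m t. strict_mono m \<longrightarrow> a \<le> m 0 \<longrightarrow>
    (\<forall>k. P (m k) (m (Suc k)) (t k)) \<longrightarrow> (\<forall>K. (\<Sum>k<K. cmod (t k x)) \<le> e / 4))" for x and a :: nat
  have T_mono: "T x b" if "T x a" "a \<le> b" for x a b
    using that unfolding T_def by (meson order_trans)
  \<comment> \<open>A state consists of the start of the next block, the function \<open>n \<mapsto> \<Sum>\<bar>t (X n)\<bar>\<close> summed over the
    functionals \<open>t\<close> chosen so far, the last chosen functional and the last chosen index.\<close>
  define Inv :: "nat \<Rightarrow> nat \<times> (nat \<Rightarrow> real) \<times> (oper \<Rightarrow> complex) \<times> nat \<Rightarrow> bool"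
    where "Inv k s \<longleftrightarrow> (case s of (m, g, t, n) \<Rightarrow> g \<longlonglongrightarrow> 0 \<and> (k = 0 \<longrightarrow> g = (\<lambda>_. 0)))" for k s
  define Step :: "nat \<Rightarrow> nat \<times> (nat \<Rightarrow> real) \<times> (oper \<Rightarrow> complex) \<times> nat
      \<Rightarrow> nat \<times> (nat \<Rightarrow> real) \<times> (oper \<Rightarrow> complex) \<times> nat \<Rightarrow> bool"
    where "Step k s s' \<longleftrightarrow> (case s of (m, g, _, _) \<Rightarrow> case s' of (m', g', t, n) \<Rightarrow>
      m < m' \<and> P m m' t \<and> k \<le> n \<and> g n < e / 4 \<and> e < cmod (t (X n)) \<and>
      g' = (\<lambda>n. g n + cmod (t (X n))) \<and> T (X n) m')" for k s s'
  have "\<exists>f. \<forall>k. Inv k (f k) \<and> Step k (f k) (f (Suc k))"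
  proof (rule dependent_nat_choice)
    show "\<exists>s. Inv 0 s"
      by (rule exI[of _ "(0, (\<lambda>_. 0), (\<lambda>_. 0), 0)"]) (simp add: Inv_def)
  next
    fix s k assume "Inv k s"
    obtain m g t0 n0 where s: "s = (m, g, t0, n0)"
      by (cases s)
    have "g \<longlonglongrightarrow> 0"
      using \<open>Inv k s\<close> by (simp add: Inv_def s)
    then have "\<forall>\<^sub>F n in sequentially. g n < e / 4"
      by (rule order_tendstoD) (use e in simp)
    then obtain N where N: "\<And>n. n \<ge> N \<Longrightarrow> g n < e / 4"
      unfolding eventually_sequentially by blast
    obtain n b t where t: "n \<ge> max N k" "b > m" "P m b t" "e < cmod (t (X n))"
      using big by blast
    obtain a where a: "T (X n) a"
      using tail[OF XS, of "e / 4" n] e unfolding T_def by auto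
    have "(\<lambda>n. g n + cmod (t (X n))) \<longlonglongrightarrow> 0 + 0"
      using X functional[OF t(3)] unfolding weakly_null_def
      by (intro tendsto_add \<open>g \<longlonglongrightarrow> 0\<close> tendsto_norm_zero) blast
    then have "Inv (Suc k) (max a b, (\<lambda>n. g n + cmod (t (X n))), t, n)"
      by (simp add: Inv_def)
    moreover have "Step k s (max a b, (\<lambda>n. g n + cmod (t (X n))), t, n)"
      unfolding Step_def s using t N mono[OF t(3), of "max a b"] T_mono[OF a, of "max a b"] by simp
    ultimately show "\<exists>s'. Inv (Suc k) s' \<and> Step k s s'"
      by blast
  qed
  then obtain f where f: "\<And>k. Inv k (f k)" "\<And>k. Step k (f k) (f (Suc k))"
    by blast
  define m where "m k = fst (f k)" for k
  define g where "g k = fst (snd (f k))" for k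
  define t where "t k = fst (snd (snd (f (Suc k))))" for k
  define n where "n k = snd (snd (snd (f (Suc k))))" for k
  have step: "m k < m (Suc k)" "P (m k) (m (Suc k)) (t k)" "k \<le> n k" "g k (n k) < e / 4"
    "e < cmod (t k (X (n k)))" "g (Suc k) = (\<lambda>i. g k i + cmod (t k (X i)))"
    "T (X (n k)) (m (Suc k))" for k
    using f(2)[of k] unfolding Step_def m_def g_def t_def n_def
    by (auto simp: case_prod_unfold)
  have g0: "g 0 = (\<lambda>_. 0)"
    using f(1)[of 0] unfolding Inv_def g_def by (auto simp: case_prod_unfold)
  have g_eq: "g k i = (\<Sum>j<k. cmod (t j (X i)))" for k i
    by (induction k) (simp_all add: g0 step(6))
  have sm: "strict_mono m"
    by (rule strict_monoI_Suc) (rule step)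
  obtain C where C: "\<And>x K. x \<in> schatten l1 \<Longrightarrow>
      (\<Sum>k<K. cmod (t k x)) \<le> C * schatten_norm l1_norm x"
    using sum[OF sm step(2)] by blast
  have F: "bounded_functional (\<lambda>x. \<Sum>k. t k x)"
    by (rule bounded_functional_suminf(1)[OF functional[OF step(2)]]) (rule C)
  have low: "e / 2 < cmod (\<Sum>j. t j (X (n k)))" for k
  proof -
    let ?x = "X (n k)"
    have abs: "summable (\<lambda>j. cmod (t j ?x))"
      by (rule bounded_functional_suminf(2)[OF functional[OF step(2)] _ XS]) (rule C)
    then have s: "summable (\<lambda>j. t j ?x)"
      by (rule summable_norm_cancel)
    have abs': "summable (\<lambda>j. cmod (t (j + Suc k) ?x))"
      using abs by (subst summable_iff_shift)
    have "(\<Sum>j<K. cmod (t (j + Suc k) ?x)) \<le> e / 4" for K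
    proof -
      have "strict_mono (\<lambda>j. m (j + Suc k))"
        using sm by (simp add: strict_mono_def)
      moreover have "P (m (j + Suc k)) (m (Suc j + Suc k)) (t (j + Suc k))" for j
        using step(2)[of "j + Suc k"] by simp
      ultimately show ?thesis
        using step(7)[of k, unfolded T_def, rule_format, of "\<lambda>j. m (j + Suc k)" "\<lambda>j. t (j + Suc k)" K]
        by simp
    qed
    then have "(\<Sum>j. cmod (t (j + Suc k) ?x)) \<le> e / 4"
      by (intro suminf_le_const abs')
    then have rest: "cmod (\<Sum>j. t (j + Suc k) ?x) \<le> e / 4"
      using summable_norm[OF abs'] by linarith
    have "cmod (\<Sum>j<k. t j ?x) \<le> (\<Sum>j<k. cmod (t j ?x))"
      by (rule norm_sum)
    then have first: "cmod (\<Sum>j<k. t j ?x) < e / 4"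
      using step(4)[of k] by (simp add: g_eq)
    define A B where "A = (\<Sum>j. t (j + Suc k) ?x)" and "B = (\<Sum>j<k. t j ?x)"
    have "(\<Sum>j. t j ?x) = A + (B + t k ?x)"
      unfolding A_def B_def using suminf_split_initial_segment[OF s, of "Suc k"] by simp
    then have "t k ?x = (\<Sum>j. t j ?x) - A - B"
      by (simp add: algebra_simps)
    then have "cmod (t k ?x) \<le> cmod (\<Sum>j. t j ?x) + cmod A + cmod B"
      using norm_triangle_ineq4[of "(\<Sum>j. t j ?x) - A" B]
        norm_triangle_ineq4[of "\<Sum>j. t j ?x" A] by simp
    then show ?thesis
      using rest first step(5)[of k] unfolding A_def B_def by linarith
  qed
  have "(\<lambda>i. \<Sum>j. t j (X i)) \<longlonglongrightarrow> 0"
    using X F unfolding weakly_null_def by blast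
  then obtain N where N: "\<And>i. i \<ge> N \<Longrightarrow> cmod (\<Sum>j. t j (X i)) < e / 2"
    using LIMSEQ_D[of _ 0 "e / 2"] e by (metis diff_zero half_gt_zero)
  show False
    using N[of "n N"] step(3)[of N] low[of N] by simp
qed

lemma sum_geometric_half_le: "(\<Sum>k<K. (1 / 2 :: real) ^ k) \<le> 2"
  by (induction K) (auto simp: sum_gp_strict)

text \<open>Weakly null sequences are eventually bounded in operator norm. This case of the uniform
  boundedness principle is the gliding hump for the functionals \<open>x \<mapsto> \<langle>x u, v\<rangle>\<close> in which the block
  only prescribes the size \<open>(1/2)\<^sup>a\<close> of \<open>v\<close>.\<close>

lemma weakly_null_bounded:
  assumes X: "weakly_null X"
  shows "\<exists>C N. \<forall>n\<ge>N. norm (X n) \<le> C"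
proof -
  define P where "P a b t \<longleftrightarrow> (\<exists>u v. norm u \<le> 1 \<and> norm v \<le> (1 / 2) ^ a \<and>
    t = (\<lambda>x :: oper. cinner (x u) v))" for a b :: nat and t
  have term_le: "cmod (t x) \<le> norm x * (1 / 2) ^ a" if "P a b t" for a b t x
  proof -
    obtain u v where uv: "norm u \<le> 1" "norm v \<le> (1 / 2) ^ a" "t = (\<lambda>x :: oper. cinner (x u) v)"
      using \<open>P a b t\<close> unfolding P_def by blast
    have "cmod (t x) \<le> norm x * norm u * norm v"
      unfolding uv(3) by (rule cinner_blinfun_le)
    also have "\<dots> \<le> norm x * 1 * (1 / 2) ^ a"
      using uv by (intro mult_mono) auto
    finally show ?thesis
      by simp
  qed
  have sum_le: "(\<Sum>k<K. cmod (t k x)) \<le> norm x * (1 / 2) ^ a * 2"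
    if "strict_mono m" "a \<le> m 0" "\<And>k. P (m k) (m (Suc k)) (t k)" for m t x a K
  proof -
    have "(\<Sum>k<K. cmod (t k x)) \<le> (\<Sum>k<K. norm x * (1 / 2) ^ a * (1 / 2) ^ k)"
    proof (rule sum_mono)
      fix k
      have "m 0 + k \<le> m k"
        by (induction k) (use that(1) in \<open>auto simp: strict_mono_Suc_iff Suc_le_eq
            intro: le_less_trans\<close>)
      then have "(1 / 2 :: real) ^ m k \<le> (1 / 2) ^ (a + k)"
        using that(2) by (intro power_decreasing) auto
      then have "norm x * (1 / 2) ^ m k \<le> norm x * (1 / 2) ^ (a + k)"
        by (rule mult_left_mono) simp
      then show "cmod (t k x) \<le> norm x * (1 / 2) ^ a * (1 / 2) ^ k"
        using term_le[OF that(3), of k x] by (simp add: power_add mult.assoc)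
    qed
    also have "\<dots> = norm x * (1 / 2) ^ a * (\<Sum>k<K. (1 / 2) ^ k)"
      by (simp add: sum_distrib_left)
    also have "\<dots> \<le> norm x * (1 / 2) ^ a * 2"
      by (intro mult_left_mono sum_geometric_half_le) simp
    finally show ?thesis .
  qed
  have "\<exists>a N. \<forall>n\<ge>N. \<forall>b>a. \<forall>t. P a b t \<longrightarrow> cmod (t (X n)) \<le> 1"
  proof (rule gliding_hump[OF X])
    show "bounded_functional t" if "P a b t" for a b t
      using that unfolding P_def by (auto intro: bounded_functional_cinner)
    show "P a c t" if "P a b t" for a b c t
      using that unfolding P_def .
    show "\<exists>C. \<forall>x\<in>schatten l1. \<forall>K. (\<Sum>k<K. cmod (t k x)) \<le> C * schatten_norm l1_norm x"
      if "strict_mono m" "\<And>k. P (m k) (m (Suc k)) (t k)" for m t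
    proof (intro exI[of _ 2] ballI allI)
      fix x K assume "x \<in> schatten l1"
      then show "(\<Sum>k<K. cmod (t k x)) \<le> 2 * schatten_norm l1_norm x"
        using sum_le[OF that(1) _ that(2), where a = 0 and K = K and x = x] norm_le_trace_norm[of x] by simp
    qed
    show "\<exists>a. \<forall>m t. strict_mono m \<longrightarrow> a \<le> m 0 \<longrightarrow> (\<forall>k. P (m k) (m (Suc k)) (t k)) \<longrightarrow>
        (\<forall>K. (\<Sum>k<K. cmod (t k x)) \<le> e)" if "0 < e" for x and e :: real
    proof -
      have "(\<lambda>a. norm x * (1 / 2) ^ a * 2) \<longlonglongrightarrow> norm x * 0 * 2"
        by (intro tendsto_intros LIMSEQ_realpow_zero) auto
      then have "\<forall>\<^sub>F a in sequentially. norm x * (1 / 2) ^ a * 2 < e"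
        by (rule order_tendstoD) (use that in simp)
      then obtain a where "norm x * (1 / 2) ^ a * 2 < e"
        using eventually_happens by fastforce
      then show ?thesis
        using sum_le by (intro exI[of _ a]) (meson less_imp_le order_trans)
    qed
  qed simp
  then obtain a N where aN: "\<And>n b t. n \<ge> N \<Longrightarrow> b > a \<Longrightarrow> P a b t \<Longrightarrow> cmod (t (X n)) \<le> 1"
    by blast
  have "norm (X n) \<le> 2 ^ a" if "n \<ge> N" for n
  proof (rule norm_blinfun_bound)
    fix u
    show "norm (X n u) \<le> 2 ^ a * norm u"
    proof (cases "u = 0")
      case False
      show ?thesis
      proof (rule norm_le_of_cinner)
        fix w
        show "cmod (cinner (X n u) w) \<le> 2 ^ a * norm u * norm w"
        proof (cases "w = 0")
          case w: False
          have "P a (Suc a) (\<lambda>x. cinner (x (inverse (norm u) *\<^sub>R u))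
              (((1 / 2) ^ a * inverse (norm w)) *\<^sub>R w))"
            unfolding P_def using False w by (intro exI conjI refl) auto
          from aN[OF that _ this]
          have "inverse (norm u) * ((1 / 2) ^ a * inverse (norm w)) * cmod (cinner (X n u) w) \<le> 1"
            unfolding blinfun.scaleR_right unfolding scaleR_eq_scaleC
            by (simp add: norm_mult norm_inverse norm_divide norm_power mult_ac)
          then show ?thesis
            using False w by (simp add: field_simps)
        qed simp
      qed simp
    qed simp
  qed simp
  then show ?thesis
    by blast
qed

text \<open>The functionals \<open>x \<mapsto> \<Sum>\<langle>x u\<^sub>l, v\<^sub>l\<rangle>\<close> for finite orthonormal families of vectors supported in the
  index block from \<open>a\<close> to \<open>b\<close>. The largest value of these functionals at \<open>x\<close> is the trace norm of the section of
  \<open>x\<close> to this block.\<close>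

definition block_functional :: "nat \<Rightarrow> nat \<Rightarrow> (oper \<Rightarrow> complex) \<Rightarrow> bool" where
  "block_functional a b t \<longleftrightarrow> (\<exists>k u v. orthonormal {..<k :: nat} u \<and> orthonormal {..<k} v \<and>
     (\<forall>l<k. proj {a..<b} (u l) = u l \<and> proj {a..<b} (v l) = v l) \<and>
     t = (\<lambda>x. \<Sum>l<k. cinner (x (u l)) (v l)))"

lemma proj_mono: "proj F w = w \<Longrightarrow> F \<subseteq> G \<Longrightarrow> proj G w = w"
  by (metis Int_absorb1 proj_proj)

lemma cinner_disjoint:
  assumes "proj F v = v" "proj G w = w" "F \<inter> G = {}"
  shows "cinner v w = 0"
proof -
  have "cinner v w = cinner v (proj (F \<inter> G) w)"
    using assms(1,2) by (metis cinner_proj proj_proj)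
  also have "proj (F \<inter> G) w = 0"
    using assms(3) by (intro coord_eqI) simp
  finally show ?thesis
    by simp
qed

text \<open>The families of disjoint blocks join to one orthonormal family, so Ky Fan's inequality applies
  to a sum of block functionals.\<close>

lemma sum_block_functionals_le:
  assumes x: "x \<in> schatten l1" and m: "strict_mono m" "a \<le> m 0"
    and t: "\<And>k. block_functional (m k) (m (Suc k)) (t k)"
  shows "(\<Sum>k<K. cmod (t k x)) \<le> schatten_norm l1_norm (proj {a..} o\<^sub>L x o\<^sub>L proj {a..})"
proof -
  define y where "y = proj {a..} o\<^sub>L x o\<^sub>L proj {a..}"
  have "y \<in> schatten l1"
    unfolding y_def using x by (intro compose_contractions_schatten_l1 norm_proj_le) auto
  then have y: "y \<in> B_ell2" "summable (singular_number y)"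
    by (simp_all add: schatten_l1_iff)
  have "\<exists>p. \<forall>k. case p k of (q, u, v) \<Rightarrow> orthonormal {..<q :: nat} u \<and> orthonormal {..<q} v \<and>
      (\<forall>l<q. proj {m k..<m (Suc k)} (u l) = u l \<and> proj {m k..<m (Suc k)} (v l) = v l) \<and>
      t k = (\<lambda>x. \<Sum>l<q. cinner (x (u l)) (v l))"
  proof (rule choice, rule allI)
    fix k
    obtain q u v where "orthonormal {..<q :: nat} u \<and> orthonormal {..<q} v \<and>
      (\<forall>l<q. proj {m k..<m (Suc k)} (u l) = u l \<and> proj {m k..<m (Suc k)} (v l) = v l) \<and>
      t k = (\<lambda>x. \<Sum>l<q. cinner (x (u l)) (v l))"
      using t[of k] unfolding block_functional_def by blast
    then show "\<exists>p. case p of (q, u, v) \<Rightarrow> orthonormal {..<q :: nat} u \<and> orthonormal {..<q} v \<and>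
      (\<forall>l<q. proj {m k..<m (Suc k)} (u l) = u l \<and> proj {m k..<m (Suc k)} (v l) = v l) \<and>
      t k = (\<lambda>x. \<Sum>l<q. cinner (x (u l)) (v l))"
      by (intro exI[of _ "(q, u, v)"]) simp
  qed
  then obtain p where p: "\<And>k. case p k of (q, u, v) \<Rightarrow> orthonormal {..<q :: nat} u \<and>
      orthonormal {..<q} v \<and>
      (\<forall>l<q. proj {m k..<m (Suc k)} (u l) = u l \<and> proj {m k..<m (Suc k)} (v l) = v l) \<and>
      t k = (\<lambda>x. \<Sum>l<q. cinner (x (u l)) (v l))"
    by blast
  define q u v where "q k = fst (p k)" and "u k = fst (snd (p k))" and "v k = snd (snd (p k))" for k
  have q: "\<And>k. orthonormal {..<q k :: nat} (u k)" "\<And>k. orthonormal {..<q k} (v k)"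
    "\<And>k l. l < q k \<Longrightarrow> proj {m k..<m (Suc k)} (u k l) = u k l"
    "\<And>k l. l < q k \<Longrightarrow> proj {m k..<m (Suc k)} (v k l) = v k l"
    "\<And>k. t k = (\<lambda>x. \<Sum>l<q k. cinner (x (u k l)) (v k l))"
    using p unfolding q_def u_def v_def by (simp_all add: case_prod_unfold)
  have disj: "{m j..<m (Suc j)} \<inter> {m k..<m (Suc k)} = {}" if "j \<noteq> k" for j k
    using that strict_mono_less_eq[OF m(1), of "Suc j" k] strict_mono_less_eq[OF m(1), of "Suc k" j]
    by (cases "j < k") auto
  have on: "orthonormal (SIGMA k:{..<K}. {..<q k}) (\<lambda>(k, l). w k l)"
    if "\<And>k. orthonormal {..<q k} (w k)"
      "\<And>k l. l < q k \<Longrightarrow> proj {m k..<m (Suc k)} (w k l) = w k l" for w :: "nat \<Rightarrow> nat \<Rightarrow> ell2"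
    unfolding orthonormal_def
  proof (clarsimp, intro conjI impI)
    fix k l k' l' assume kl: "l < q k" "l' < q k'"
    show "cinner (w k l) (w k l) = 1"
      using orthonormalD[OF that(1)] kl by simp
    assume "k = k' \<longrightarrow> l \<noteq> l'"
    then show "cinner (w k l) (w k' l') = 0"
      using orthonormalD[OF that(1), of l k l'] kl
        cinner_disjoint[OF that(2)[OF kl(1)] that(2)[OF kl(2)] disj] by (cases "k = k'") auto
  qed
  have a: "a \<le> m k" for k
    using m strict_mono_less_eq[OF m(1), of 0 k] by simp
  have "(\<Sum>k<K. cmod (t k x)) \<le> (\<Sum>k<K. \<Sum>l<q k. cmod (cinner (y (u k l)) (v k l)))"
  proof (rule sum_mono)
    fix k
    have "cinner (x (u k l)) (v k l) = cinner (y (u k l)) (v k l)" if "l < q k" for l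
    proof -
      have "proj {a..} (u k l) = u k l" "proj {a..} (v k l) = v k l"
        using a[of k] by (auto intro!: proj_mono[OF q(3)[OF that]] proj_mono[OF q(4)[OF that]])
      then show ?thesis
        by (simp add: y_def cinner_proj)
    qed
    then show "cmod (t k x) \<le> (\<Sum>l<q k. cmod (cinner (y (u k l)) (v k l)))"
      unfolding q(5) by (auto intro!: order_trans[OF norm_sum] sum_mono)
  qed
  also have "\<dots> = (\<Sum>p\<in>(SIGMA k:{..<K}. {..<q k}).
      cmod (cinner (y ((\<lambda>(k, l). u k l) p)) ((\<lambda>(k, l). v k l) p)))"
    by (subst sum.Sigma) (auto simp: case_prod_unfold)
  also have "\<dots> \<le> (\<Sum>n. singular_number y n)"
  proof (rule sum_cinner_le_trace_norm[OF y, where F = "{..<m K}"])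
    have "{m k..<m (Suc k)} \<subseteq> {..<m K}" if "k < K" for k
      using that strict_mono_less_eq[OF m(1), of "Suc k" K] by auto
    then show "proj {..<m K} ((\<lambda>(k, l). u k l) p) = (\<lambda>(k, l). u k l) p"
      "proj {..<m K} ((\<lambda>(k, l). v k l) p) = (\<lambda>(k, l). v k l) p"
      if "p \<in> (SIGMA k:{..<K}. {..<q k})" for p
      using that by (auto intro: proj_mono[OF q(3)] proj_mono[OF q(4)])
  qed (auto intro: on q)
  finally show ?thesis
    by (simp add: y_def trace_norm_eq)
qed

text \<open>The corners of a weakly null sequence of trace class operators are eventually uniformly small:
  this is the gliding hump for block functionals.\<close>

proposition weakly_null_corners_small:
  assumes X: "weakly_null X" and e: "0 < e"
  shows "\<exists>a N. \<forall>n\<ge>N. schatten_norm l1_norm (proj {a..} o\<^sub>L X n o\<^sub>L proj {a..}) \<le> e"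
proof -
  have XS: "X n \<in> schatten l1" for n
    using X by (simp add: weakly_null_def)
  have "\<exists>a N. \<forall>n\<ge>N. \<forall>b>a. \<forall>t. block_functional a b t \<longrightarrow> cmod (t (X n)) \<le> e"
  proof (rule gliding_hump[OF X _ _ _ _ e])
    show "bounded_functional t" if "block_functional a b t" for a b t
      using that unfolding block_functional_def by (auto intro: bounded_functional_sum_cinner)
    show "block_functional a c t" if t: "block_functional a b t" and "b \<le> c" for a b c t
    proof -
      have "{a..<b} \<subseteq> {a..<c}"
        using \<open>b \<le> c\<close> by auto
      obtain k :: nat and u v where uv: "orthonormal {..<k} u" "orthonormal {..<k} v"
        "\<forall>l<k. proj {a..<b} (u l) = u l \<and> proj {a..<b} (v l) = v l"
        "t = (\<lambda>x. \<Sum>l<k. cinner (x (u l)) (v l))"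
        using t unfolding block_functional_def by blast
      have "\<forall>l<k. proj {a..<c} (u l) = u l \<and> proj {a..<c} (v l) = v l"
        using uv(3) proj_mono[OF _ \<open>{a..<b} \<subseteq> {a..<c}\<close>] by blast
      then show ?thesis
        unfolding block_functional_def using uv by blast
    qed
    show "\<exists>C. \<forall>x\<in>schatten l1. \<forall>K. (\<Sum>k<K. cmod (t k x)) \<le> C * schatten_norm l1_norm x"
      if "strict_mono m" "\<And>k. block_functional (m k) (m (Suc k)) (t k)" for m t
    proof (intro exI[of _ 1] ballI allI)
      fix x K assume x: "x \<in> schatten l1"
      have "(\<Sum>k<K. cmod (t k x)) \<le> schatten_norm l1_norm (proj {0..} o\<^sub>L x o\<^sub>L proj {0..})"
        using x that by (intro sum_block_functionals_le) auto
      also have "\<dots> \<le> schatten_norm l1_norm x"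
        using x by (intro compose_contractions_schatten_l1 norm_proj_le) auto
      finally show "(\<Sum>k<K. cmod (t k x)) \<le> 1 * schatten_norm l1_norm x"
        by simp
    qed
    show "\<exists>a. \<forall>m t. strict_mono m \<longrightarrow> a \<le> m 0 \<longrightarrow>
        (\<forall>k. block_functional (m k) (m (Suc k)) (t k)) \<longrightarrow> (\<forall>K. (\<Sum>k<K. cmod (t k x)) \<le> e)"
      if x: "x \<in> schatten l1" and e: "0 < e" for x and e :: real
    proof -
      have "\<forall>\<^sub>F a in sequentially.
          schatten_norm l1_norm (proj {a..} o\<^sub>L x o\<^sub>L proj {a..}) < e"
        using corner_trace_norm_tendsto[OF x] e by (rule order_tendstoD)
      then obtain a where "schatten_norm l1_norm (proj {a..} o\<^sub>L x o\<^sub>L proj {a..}) < e"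
        using eventually_happens by fastforce
      then show ?thesis
        using sum_block_functionals_le[OF x] by (intro exI[of _ a]) (meson less_imp_le order_trans)
    qed
  qed
  then obtain a N where aN: "\<And>n b t. n \<ge> N \<Longrightarrow> b > a \<Longrightarrow> block_functional a b t \<Longrightarrow>
      cmod (t (X n)) \<le> e"
    by blast
  have "schatten_norm l1_norm (proj {a..} o\<^sub>L X n o\<^sub>L proj {a..}) \<le> e" if n: "n \<ge> N" for n
  proof -
    define y where "y = proj {a..} o\<^sub>L X n o\<^sub>L proj {a..}"
    have "y \<in> schatten l1"
      unfolding y_def using XS by (intro compose_contractions_schatten_l1 norm_proj_le) auto
    then have y: "y \<in> B_ell2" "summable (singular_number y)"
      by (simp_all add: schatten_l1_iff)
    have "(\<Sum>i<K. singular_number y i) \<le> e" for K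
    proof (rule LIMSEQ_le_const)
      let ?D = "\<lambda>b. norm (y - (proj {..<b} o\<^sub>L y o\<^sub>L proj {..<b}))"
      have "(\<lambda>b. e + K * ?D b) \<longlonglongrightarrow> e + real K * 0"
        by (intro tendsto_intros compact_truncation_tendsto y summable_LIMSEQ_zero)
      then show "(\<lambda>b. e + K * ?D b) \<longlonglongrightarrow> e"
        by simp
      have "(\<Sum>i<K. singular_number y i) \<le> e + K * ?D b" if "b > a" for b
      proof -
        have X: "X n \<in> B_ell2"
          using XS by (simp add: schatten_l1_iff)
        obtain k :: nat and u v where uv: "orthonormal {..<k} u" "orthonormal {..<k} v"
          "\<And>l. l < k \<Longrightarrow> proj {a..<b} (u l) = u l" "\<And>l. l < k \<Longrightarrow> proj {a..<b} (v l) = v l"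
          "\<And>K. (\<Sum>i<K. singular_number (proj {a..<b} o\<^sub>L X n o\<^sub>L proj {a..<b}) i)
            \<le> cmod (\<Sum>l<k. cinner (X n (u l)) (v l))"
          by (rule trace_norm_section_attained[OF X, of "{a..<b}"]) auto
        have "block_functional a b (\<lambda>x. \<Sum>l<k. cinner (x (u l)) (v l))"
          unfolding block_functional_def
          by (rule exI[of _ k], rule exI[of _ u], rule exI[of _ v]) (simp add: uv)
        then have "cmod (\<Sum>l<k. cinner (X n (u l)) (v l)) \<le> e"
          by (rule aN[OF n that])
        have "{..<b} \<inter> {a..} = {a..<b}" "{a..} \<inter> {..<b} = {a..<b}"
          by auto
        then have "proj {..<b} o\<^sub>L y o\<^sub>L proj {..<b} = proj {a..<b} o\<^sub>L X n o\<^sub>L proj {a..<b}"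
          by (intro blinfun_eqI) (simp add: y_def)
        then have "(\<Sum>i<K. singular_number y i) \<le>
            (\<Sum>i<K. singular_number (proj {a..<b} o\<^sub>L X n o\<^sub>L proj {a..<b}) i + ?D b)"
          by (intro sum_mono) (metis singular_number_perturb)
        also have "\<dots> = (\<Sum>i<K. singular_number (proj {a..<b} o\<^sub>L X n o\<^sub>L proj {a..<b}) i) + K * ?D b"
          by (simp add: sum.distrib)
        finally show ?thesis
          using uv(5)[of K] \<open>cmod _ \<le> e\<close> by linarith
      qed
      then show "\<exists>b0. \<forall>b\<ge>b0. (\<Sum>i<K. singular_number y i) \<le> e + K * ?D b"
        by (intro exI[of _ "Suc a"]) auto
    qed
    then show ?thesis
      unfolding trace_norm_eq y_def[symmetric] by (intro suminf_le_const y)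
  qed
  then show ?thesis
    by blast
qed


section \<open>Symmetric sequence spaces\<close>

text \<open>This comparison covers pointwise domination, truncations and shifts.\<close>

lemma rearrangement_le_of_inj:
  assumes inj: "inj_on p {k. y k \<noteq> 0}"
    and le: "\<And>k. y k \<noteq> 0 \<Longrightarrow> cmod (y k) \<le> cmod (x (p k))"
  shows "rearrangement y n \<le> rearrangement x n"
  unfolding rearrangement_def
proof (rule Inf_superset_mono, clarify)
  fix t assume fin: "finite {k. t < ennreal (cmod (x k))}"
    and card: "card {k. t < ennreal (cmod (x k))} \<le> n"
  let ?Y = "{k. t < ennreal (cmod (y k))}"
  have sub: "?Y \<subseteq> {k. y k \<noteq> 0}"
    by auto
  have img: "p ` ?Y \<subseteq> {k. t < ennreal (cmod (x k))}"
    using sub le by (force intro: less_le_trans ennreal_leI)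
  have inj': "inj_on p ?Y"
    using inj sub by (rule inj_on_subset)
  show "finite ?Y \<and> card ?Y \<le> n"
    using finite_subset[OF img fin] finite_imageD[OF _ inj'] card_inj_on_le[OF inj' img fin] card
    by auto
qed

context symmetric_sequence_space
begin

lemma dominated:
  assumes "x \<in> E" "inj_on p {k. y k \<noteq> 0}"
    and "\<And>k. y k \<noteq> 0 \<Longrightarrow> cmod (y k) \<le> cmod (x (p k))"
  shows "y \<in> E" "N y \<le> N x"
  using symmetric[OF assms(1) rearrangement_le_of_inj[where p = p, OF assms(2,3)]] by auto

text \<open>The unit sequences.\<close>

abbreviation delta :: "nat \<Rightarrow> nat \<Rightarrow> complex" where
  "delta k \<equiv> (\<lambda>n. if n = k then 1 else 0)"

lemma delta_mem:
  assumes "x \<in> E" "x k \<noteq> 0"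
  shows "delta l \<in> E"
  using scale_mem[OF assms(1), of "inverse (x k)"]
  by (rule dominated(1)[where p = "\<lambda>_. k"])
    (use assms(2) in \<open>auto simp: norm_mult norm_inverse inj_on_def split: if_splits\<close>)

lemma initial_segment_mem:
  assumes "delta 0 \<in> E"
  shows "(\<lambda>n. if n < r then 1 else 0) \<in> E"
proof (induction r)
  case 0
  show ?case
    using zero_mem by simp
next
  case (Suc r)
  have "(\<lambda>n. if n < Suc r then 1 else 0) = (\<lambda>n. (if n < r then 1 else 0) + delta r n)"
    by (auto simp: less_Suc_eq)
  then show ?case
    using add_mem[OF Suc.IH delta_mem[OF assms, of 0 r]] by simp
qed

lemma delta_norm_pos: "delta 0 \<in> E \<Longrightarrow> 0 < N (delta 0)"
  using norm_nonneg[of "delta 0"] norm_eq_zero[of "delta 0"]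
  by (metis less_eq_real_def zero_neq_one)

text \<open>The first \<open>r\<close> singular numbers of \<open>x + R\<close> exceed those of \<open>x\<close> by at most the operator norm of \<open>R\<close>,
  and the others are dominated by those of \<open>x\<close>, shifted by \<open>r\<close> places. The factor \<open>2\<close> comes from
  estimating both parts by the full sequence.\<close>

lemma schatten_norm_perturb:
  assumes x: "x \<in> schatten E" and d: "delta 0 \<in> E" and R: "R \<in> B_ell2" "rank_le r R"
  shows "schatten_norm N (x + R) \<le>
    2 * schatten_norm N x + norm R * N (\<lambda>n. if n < r then 1 else 0)"
proof -
  define s where "s n = complex_of_real (singular_number x n)" for n
  define A where "A n = (if n < r then s n else 0)" for n
  define B where "B n = (if n < r then 0 else s (n - r))" for n
  define D where "D n = complex_of_real (norm R) * (if n < r then 1 else 0)" for n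
  have s: "s \<in> E"
    using x by (simp add: schatten_def s_def[abs_def])
  have A: "A \<in> E" "N A \<le> N s"
    by (rule dominated[OF s, where p = "\<lambda>n. n"]; simp add: A_def)+
  have "inj_on (\<lambda>n. n - r) {n. B n \<noteq> 0}"
    by (auto simp: inj_on_def B_def split: if_splits)
  then have B: "B \<in> E" "N B \<le> N s"
    by (rule dominated[OF s, where p = "\<lambda>n. n - r"]; simp add: B_def split: if_splits)+
  note ini = initial_segment_mem[OF d, of r]
  have D: "D \<in> E" "N D = norm R * N (\<lambda>n. if n < r then 1 else 0)"
    using scale_mem[OF ini] norm_scale[OF ini, of "complex_of_real (norm R)"]
    by (simp_all add: D_def[abs_def])
  define Z where "Z = (\<lambda>n. (A n + B n) + D n)"
  have Z: "Z \<in> E"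
    unfolding Z_def by (intro add_mem A B D)
  have "N Z \<le> N (\<lambda>n. A n + B n) + N D"
    unfolding Z_def by (intro norm_triangle add_mem A B D)
  also have "N (\<lambda>n. A n + B n) \<le> N A + N B"
    by (intro norm_triangle A B)
  finally have NZ: "N Z \<le> 2 * N s + norm R * N (\<lambda>n. if n < r then 1 else 0)"
    using A B D by simp
  have "cmod (complex_of_real (singular_number (x + R) n)) \<le> cmod (Z n)" for n
  proof (cases "n < r")
    case True
    have "singular_number (x + R) n \<le> singular_number x n + norm R"
      using singular_number_perturb[of "x + R" n x] by simp
    moreover have "Z n = complex_of_real (singular_number x n + norm R)"
      using True by (simp add: Z_def A_def B_def D_def s_def)
    ultimately show ?thesis
      by (simp add: singular_number_nonneg del: of_real_add)
  next
    case False
    then have "singular_number (x + R) n \<le> singular_number x (n - r)"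
      using singular_number_add_rank_le[OF R, of x "n - r"] by simp
    moreover have "Z n = complex_of_real (singular_number x (n - r))"
      using False by (simp add: Z_def A_def B_def D_def s_def)
    ultimately show ?thesis
      by (simp add: singular_number_nonneg)
  qed
  then have "N (\<lambda>n. complex_of_real (singular_number (x + R) n)) \<le> N Z"
    by (intro dominated(2)[OF Z, where p = "\<lambda>n. n"]) auto
  then show ?thesis
    using NZ by (simp add: schatten_norm_def s_def[abs_def])
qed

end


section \<open>Domination of positive semidefinite kernels\<close>

text \<open>Positive semidefinite kernels on the natural numbers. As the scalars are complex, the condition
  that the quadratic form takes only nonnegative real values includes that the kernel is Hermitian.\<close>

definition psd_kernel :: "(nat \<Rightarrow> nat \<Rightarrow> complex) \<Rightarrow> bool" where
  "psd_kernel \<phi> \<longleftrightarrow> (\<forall>F c. finite F \<longrightarrow> (\<Sum>i\<in>F. \<Sum>j\<in>F. cnj (c i) * \<phi> i j * c j) \<in> \<real>\<^sub>\<ge>\<^sub>0)"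

lemma psd_kernelD:
  assumes "psd_kernel \<phi>" "finite F"
  shows "0 \<le> Re (\<Sum>i\<in>F. \<Sum>j\<in>F. cnj (c i) * \<phi> i j * c j)"
    and "Im (\<Sum>i\<in>F. \<Sum>j\<in>F. cnj (c i) * \<phi> i j * c j) = 0"
  using assms complex_nonneg_Reals_iff unfolding psd_kernel_def by blast+

lemma psd_kernel_diag:
  assumes "psd_kernel \<phi>"
  shows "Im (\<phi> i i) = 0"
  using psd_kernelD(2)[OF assms, of "{i}" "\<lambda>_. 1"] by simp

lemma psd_kernel_hermitian:
  assumes "psd_kernel \<phi>"
  shows "\<phi> j i = cnj (\<phi> i j)"
proof (cases "i = j")
  case True
  then show ?thesis
    using psd_kernel_diag[OF assms, of i] by (simp add: complex_eq_iff)
next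
  case False
  have "Im (\<phi> i j) + Im (\<phi> j i) = 0"
    using psd_kernelD(2)[OF assms, of "{i, j}" "\<lambda>_. 1"] False psd_kernel_diag[OF assms]
    by simp
  moreover have "Re (\<phi> i j) - Re (\<phi> j i) = 0"
    using psd_kernelD(2)[OF assms, of "{i, j}" "\<lambda>k. if k = i then 1 else \<i>"] False
      psd_kernel_diag[OF assms]
    by simp
  ultimately show ?thesis
    by (simp add: complex_eq_iff)
qed

text \<open>In terms of vectors \<open>e i\<close> with Gram matrix \<open>\<psi>\<close>, the kernel \<open>\<phi>\<close> has the form \<open>\<langle>A (e j), e i\<rangle>\<close> for a
  positive contraction \<open>A\<close>. The hypotheses say that the \<open>e i\<close> are bounded and tend weakly to zero on
  their closed span, which gives the conclusion. The proof replaces the Gram vectors by an explicit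
  test: if \<open>\<bar>\<phi> i j\<bar> \<ge> \<delta>\<close> for infinitely many \<open>i\<close>, pick \<open>n\<close> of these indices on which \<open>\<psi>\<close> is almost
  diagonal, and evaluate the form of \<open>\<phi>\<close> at a vector with unimodular entries at them and entry \<open>a\<close> at \<open>j\<close>.
  The cross terms contribute at most \<open>- 2 * a * n * \<delta>\<close>, the index \<open>j\<close> a fixed amount, and the other
  indices, by comparison with \<open>\<psi>\<close>, at most a fixed multiple of \<open>n\<close>; for suitable \<open>a\<close> and large \<open>n\<close> the
  total is negative.\<close>

proposition psd_kernel_dominated_tendsto:
  assumes \<phi>: "psd_kernel \<phi>" and diff: "psd_kernel (\<lambda>i j. \<psi> i j - \<phi> i j)"
    and herm: "\<And>i j. \<psi> j i = cnj (\<psi> i j)"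
    and bound: "\<And>i. cmod (\<psi> i i) \<le> M"
    and lim: "\<And>j. (\<lambda>i. \<psi> i j) \<longlonglongrightarrow> 0"
  shows "(\<lambda>i. \<phi> i j) \<longlonglongrightarrow> 0"
proof (rule ccontr)
  assume "\<not> (\<lambda>i. \<phi> i j) \<longlonglongrightarrow> 0"
  then obtain \<delta> where \<delta>: "0 < \<delta>" and freq: "\<And>i0. \<exists>i\<ge>i0. \<delta> \<le> cmod (\<phi> i j)"
    unfolding LIMSEQ_iff by (auto simp: not_less)
  have select: "\<exists>F. finite F \<and> card F = n \<and> j \<notin> F \<and> (\<forall>i\<in>F. \<delta> \<le> cmod (\<phi> i j)) \<and>
      (\<forall>i\<in>F. \<forall>k\<in>F. i \<noteq> k \<longrightarrow> cmod (\<psi> i k) \<le> \<eta>)" if "0 < \<eta>" for n and \<eta> :: real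
  proof (induction n)
    case 0
    show ?case
      by (rule exI[of _ "{}"]) simp
  next
    case (Suc n)
    then obtain F where F: "finite F" "card F = n" "j \<notin> F" "\<forall>i\<in>F. \<delta> \<le> cmod (\<phi> i j)"
      "\<forall>i\<in>F. \<forall>k\<in>F. i \<noteq> k \<longrightarrow> cmod (\<psi> i k) \<le> \<eta>"
      by blast
    have "\<forall>\<^sub>F i in sequentially. \<forall>k\<in>F. cmod (\<psi> i k) < \<eta>"
    proof (rule eventually_ball_finite[OF F(1)], rule ballI)
      fix k
      show "\<forall>\<^sub>F i in sequentially. cmod (\<psi> i k) < \<eta>"
        using tendsto_norm_zero[OF lim[of k]] that by (rule order_tendstoD)
    qed
    then obtain i0 where i0: "\<And>i k. i \<ge> i0 \<Longrightarrow> k \<in> F \<Longrightarrow> cmod (\<psi> i k) < \<eta>"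
      unfolding eventually_sequentially by blast
    obtain i where i: "i \<ge> max i0 (Suc (Max (insert j F)))" "\<delta> \<le> cmod (\<phi> i j)"
      using freq by blast
    have "Max (insert j F) < i"
      using i(1) by (simp only: max.bounded_iff Suc_le_eq)
    then have new: "i \<notin> insert j F"
      using Max_ge[of "insert j F" i] F(1) by (meson finite_insert not_le)
    have "cmod (\<psi> i k) \<le> \<eta>" "cmod (\<psi> k i) \<le> \<eta>" if "k \<in> F" for k
      using i0[of i k] i(1) that herm[of k i] by (simp_all add: less_imp_le)
    then show ?case
      using F i new by (intro exI[of _ "insert i F"]) auto
  qed
  \<comment> \<open>The entry \<open>a\<close> of the test vector at \<open>j\<close> balances the cross terms \<open>- 2 * a * n * \<delta>\<close> against the bound
    \<open>n * M'\<close> for the form of \<open>\<psi>\<close>; then \<open>n\<close> is chosen so large that the term \<open>a\<^sup>2 * \<phi> j j\<close> does not matter.\<close>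
  define M' where "M' = max M 0 + 1"
  define a where "a = M' / \<delta>"
  have "0 < M'" "0 < a"
    using \<delta> by (auto simp: M'_def a_def intro!: divide_pos_pos)
  obtain n :: nat where n: "a\<^sup>2 * cmod (\<phi> j j) / M' < n"
    using reals_Archimedean2 by blast
  moreover have "0 \<le> a\<^sup>2 * cmod (\<phi> j j) / M'"
    using \<open>0 < M'\<close> by simp
  ultimately have n0: "0 < real n"
    by linarith
  obtain F where F: "finite F" "card F = n" "j \<notin> F" "\<And>i. i \<in> F \<Longrightarrow> \<delta> \<le> cmod (\<phi> i j)"
    "\<And>i k. i \<in> F \<Longrightarrow> k \<in> F \<Longrightarrow> i \<noteq> k \<Longrightarrow> cmod (\<psi> i k) \<le> 1 / n"
    using select[of "1 / n" n] n0 by auto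
  \<comment> \<open>The phases make every term \<open>cnj (c i) * \<phi> i j\<close> equal to \<open>- \<bar>\<phi> i j\<bar>\<close>.\<close>
  define c where "c i = - (\<phi> i j / cmod (\<phi> i j))" for i
  have nz: "\<phi> i j \<noteq> 0" if "i \<in> F" for i
    using F(4)[OF that] \<delta> by auto
  have c1: "cmod (c i) = 1" if "i \<in> F" for i
    using nz[OF that] by (simp add: c_def norm_divide)
  have c\<phi>: "cnj (c i) * \<phi> i j = - complex_of_real (cmod (\<phi> i j))" if "i \<in> F" for i
    using nz[OF that] complex_norm_square[of "\<phi> i j"]
    by (simp add: c_def divide_simps power2_eq_square mult.commute)
  define q where "q \<kappa> = (\<Sum>i\<in>F. \<Sum>k\<in>F. cnj (c i) * \<kappa> i k * c k)" for \<kappa> :: "nat \<Rightarrow> nat \<Rightarrow> complex"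
  define S where "S = (\<Sum>i\<in>F. cmod (\<phi> i j))"
  have "Re (q \<phi>) \<le> Re (q \<psi>)"
    using psd_kernelD(1)[OF diff F(1), of c]
    by (simp add: q_def algebra_simps sum_subtractf)
  also have "\<dots> \<le> cmod (q \<psi>)"
    by (rule complex_Re_le_cmod)
  also have "\<dots> \<le> (\<Sum>i\<in>F. \<Sum>k\<in>F. cmod (\<psi> i k))"
    unfolding q_def
    by (intro order_trans[OF norm_sum] sum_mono) (auto simp: norm_mult c1)
  also have "\<dots> \<le> (\<Sum>i\<in>F. M')"
  proof (rule sum_mono)
    fix i assume i: "i \<in> F"
    have "(\<Sum>k\<in>F. cmod (\<psi> i k)) = cmod (\<psi> i i) + (\<Sum>k\<in>F - {i}. cmod (\<psi> i k))"
      using F(1) i by (rule sum.remove)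
    also have "(\<Sum>k\<in>F - {i}. cmod (\<psi> i k)) \<le> (\<Sum>k\<in>F - {i}. 1 / n)"
      using F(5) i by (intro sum_mono) auto
    also have "\<dots> \<le> (\<Sum>k\<in>F. 1 / n)"
      using F(1) by (intro sum_mono2) auto
    also have "\<dots> = 1"
      using F(2) n0 by simp
    finally show "(\<Sum>k\<in>F. cmod (\<psi> i k)) \<le> M'"
      using bound[of i] by (simp add: M'_def)
  qed
  also have "\<dots> = n * M'"
    by (simp add: F(2))
  finally have q\<phi>: "Re (q \<phi>) \<le> n * M'" .
  have "n * \<delta> \<le> S"
    unfolding S_def using sum_bounded_below[of F \<delta> "\<lambda>i. cmod (\<phi> i j)"] F(2,4) by simp
  define d where "d i = (if i = j then complex_of_real a else c i)" for i
  have dF: "(\<Sum>i\<in>F. f i (d i)) = (\<Sum>i\<in>F. f i (c i))" for f :: "nat \<Rightarrow> complex \<Rightarrow> complex"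
    by (rule sum.cong) (use F(3) in \<open>auto simp: d_def\<close>)
  have "(\<Sum>i\<in>insert j F. \<Sum>k\<in>insert j F. cnj (d i) * \<phi> i k * d k) =
      a * \<phi> j j * a + (\<Sum>k\<in>F. a * \<phi> j k * c k) + ((\<Sum>i\<in>F. cnj (c i) * \<phi> i j * a) + q \<phi>)"
    using F(1,3)
    by (simp add: sum.distrib q_def dF[of "\<lambda>k z. _ * \<phi> _ k * z"]
        dF[of "\<lambda>i z. cnj z * \<phi> i j * _"] dF[of "\<lambda>i z. (\<Sum>k\<in>F. cnj z * \<phi> i k * c k)"])
      (simp add: d_def)
  also have "(\<Sum>i\<in>F. cnj (c i) * \<phi> i j * a) = - (a * S)"
    by (simp add: c\<phi> S_def sum_distrib_left sum_negf mult.commute flip: of_real_mult)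
  also have "(\<Sum>k\<in>F. a * \<phi> j k * c k) = - (a * S)"
  proof -
    have "a * \<phi> j k * c k = - complex_of_real (a * cmod (\<phi> k j))" if "k \<in> F" for k
    proof -
      have "\<phi> j k * c k = cnj (cnj (c k) * \<phi> k j)"
        by (simp add: psd_kernel_hermitian[OF \<phi>, of j k] mult.commute)
      then show ?thesis
        by (simp add: c\<phi>[OF that] mult.assoc)
    qed
    then show ?thesis
      by (simp add: S_def sum_distrib_left sum_negf)
  qed
  finally have "0 \<le> Re (a * \<phi> j j * a + - (a * S) + (- (a * S) + q \<phi>))"
    using psd_kernelD(1)[OF \<phi>, of "insert j F" d] F(1) by (metis finite_insert)
  then have "0 \<le> a\<^sup>2 * Re (\<phi> j j) - 2 * (a * S) + Re (q \<phi>)"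
    by (simp add: power2_eq_square mult_ac)
  moreover have "a\<^sup>2 * Re (\<phi> j j) \<le> a\<^sup>2 * cmod (\<phi> j j)"
    by (intro mult_left_mono complex_Re_le_cmod) simp
  moreover have "a\<^sup>2 * cmod (\<phi> j j) < n * M'"
    using n \<open>0 < M'\<close> by (simp add: pos_divide_less_eq)
  moreover have "n * M' \<le> a * S"
  proof -
    have "n * M' = a * (n * \<delta>)"
      using \<delta> by (simp add: a_def)
    also have "\<dots> \<le> a * S"
      using \<open>n * \<delta> \<le> S\<close> \<open>0 < a\<close> by simp
    finally show ?thesis .
  qed
  ultimately show False
    using q\<phi> by linarith
qed


section \<open>Schur multipliers\<close>

lemma pos_oper_rank_one: "pos_oper (rank_one w w)"
proof -
  have "cinner v w * cinner w v \<in> \<real>\<^sub>\<ge>\<^sub>0" for v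
    by (subst cinner_commute[of w v], subst complex_norm_square[symmetric]) simp
  then show ?thesis
    by (simp add: pos_oper_def)
qed

text \<open>The symbol of a positive Schur multiplier is positive semidefinite, as one sees by applying
  the multiplier to the matrices with all entries in a finite square block equal to one.\<close>

lemma psd_kernel_of_pos_map:
  assumes T: "pos_map T" and entry: "\<And>x i j. x \<in> schatten l1 \<Longrightarrow> entry (T x) i j = \<phi> i j * entry x i j"
  shows "psd_kernel \<phi>"
  unfolding psd_kernel_def
proof (intro allI impI)
  fix F :: "nat set" and c :: "nat \<Rightarrow> complex" assume F: "finite F"
  define w where "w = (\<Sum>i\<in>F. unit_vec i)"
  define v where "v = (\<Sum>i\<in>F. c i *\<^sub>C unit_vec i)"
  define x where "x = rank_one w w"
  have "pos_oper (T x)"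
    using T pos_oper_rank_one rank_one_schatten_l1 unfolding pos_map_def x_def by blast
  then have B: "T x \<in> B_ell2" and pos: "cinner (T x v) v \<in> \<real>\<^sub>\<ge>\<^sub>0"
    by (auto simp: pos_oper_def)
  have e: "entry (T x) i j = \<phi> i j" if "i \<in> F" "j \<in> F" for i j
    using that F entry[of x i j] by (simp add: x_def rank_one_schatten_l1 entry_rank_one w_def)
  have "cinner (T x v) v = (\<Sum>i\<in>F. \<Sum>j\<in>F. cnj (c i) * (c j * entry (T x) i j))"
    unfolding v_def by (simp add: cinner_sum_right blinfun.sum_right B_ell2_scaleC[OF B]
        entry_def sum_distrib_left del: coord_sum cinner_unit_vec_right)
      (simp add: cinner_sum_left sum_distrib_left del: cinner_unit_vec_right coord_sum)
  also have "\<dots> = (\<Sum>i\<in>F. \<Sum>j\<in>F. cnj (c i) * \<phi> i j * c j)"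
    by (intro sum.cong refl) (simp add: e mult_ac)
  finally show "(\<Sum>i\<in>F. \<Sum>j\<in>F. cnj (c i) * \<phi> i j * c j) \<in> \<real>\<^sub>\<ge>\<^sub>0"
    using pos by simp
qed

lemma norm_rank_one: "norm (rank_one w z) = norm w * norm z"
proof (rule antisym[OF norm_rank_one_le])
  show "norm w * norm z \<le> norm (rank_one w z)"
  proof (cases "z = 0")
    case False
    have "norm (rank_one w z z) \<le> norm (rank_one w z) * norm z"
      by (rule norm_blinfun)
    moreover have "cmod (cinner z z) = norm z * norm z"
      unfolding cinner_self norm_of_real by (simp add: power2_eq_square)
    ultimately have "(norm w * norm z) * norm z \<le> norm (rank_one w z) * norm z"
      by (simp add: norm_scaleC mult_ac)
    then show ?thesis
      using False by simp
  qed simp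
qed

text \<open>A column of \<open>S\<^sub>1\<close> is a copy of \<open>\<ell>\<^sub>2\<close>, in which the basis is weakly null.\<close>

lemma matrix_unit_column_weakly_null: "weakly_null (\<lambda>i. rank_one (unit_vec i) (unit_vec j))"
  unfolding weakly_null_def
proof (intro conjI allI impI rank_one_schatten_l1)
  fix f assume f: "bounded_functional f"
  then obtain C where C: "\<And>x. x \<in> schatten l1 \<Longrightarrow> cmod (f x) \<le> C * schatten_norm l1_norm x"
    unfolding bounded_functional_def by blast
  define g where "g w = f (rank_one w (unit_vec j))" for w
  have "summable (\<lambda>k. (cmod (g (unit_vec k)))\<^sup>2)"
  proof (rule functional_square_summable)
    fix v w
    have "rank_one (v + w) (unit_vec j) = rank_one v (unit_vec j) + rank_one w (unit_vec j)"
      by (rule blinfun_eqI) (simp add: blinfun.add_left ell2.scale_right_distrib)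
    then show "g (v + w) = g v + g w"
      using f rank_one_schatten_l1 by (simp add: g_def bounded_functional_def)
  next
    fix c v
    have "rank_one (c *\<^sub>C v) (unit_vec j) = scaleC_oper c (rank_one v (unit_vec j))"
      by (rule blinfun_eqI) (simp add: scaleC_oper_apply mult.commute)
    then show "g (c *\<^sub>C v) = c * g v"
      using f rank_one_schatten_l1 by (simp add: g_def bounded_functional_def)
  next
    fix v
    have "cmod (g v) \<le> C * schatten_norm l1_norm (rank_one v (unit_vec j))"
      unfolding g_def by (intro C rank_one_schatten_l1)
    also have "\<dots> \<le> \<bar>C\<bar> * schatten_norm l1_norm (rank_one v (unit_vec j))"
      by (intro mult_right_mono trace_norm_nonneg rank_one_schatten_l1) simp
    also have "\<dots> \<le> \<bar>C\<bar> * norm v"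
      using trace_norm_rank_one_le[of v "unit_vec j"] by (intro mult_left_mono) auto
    finally show "cmod (g v) \<le> \<bar>C\<bar> * norm v" .
  qed
  then have "(\<lambda>k. sqrt ((cmod (g (unit_vec k)))\<^sup>2)) \<longlonglongrightarrow> sqrt 0"
    by (intro tendsto_real_sqrt summable_LIMSEQ_zero)
  then have "(\<lambda>k. cmod (g (unit_vec k))) \<longlonglongrightarrow> 0"
    by simp
  then show "(\<lambda>i. f (rank_one (unit_vec i) (unit_vec j))) \<longlonglongrightarrow> 0"
    unfolding g_def by (rule tendsto_norm_zero_cancel)
qed

context symmetric_sequence_space
begin

lemma schur_multiplier_B_ell2:
  "schur_multiplier E N \<phi> T \<Longrightarrow> x \<in> schatten l1 \<Longrightarrow> T x \<in> B_ell2"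
  unfolding schur_multiplier_def bounded_map_def schatten_def by blast

lemma schur_multiplier_entry:
  "schur_multiplier E N \<phi> T \<Longrightarrow> x \<in> schatten l1 \<Longrightarrow> entry (T x) i j = \<phi> i j * entry x i j"
  unfolding schur_multiplier_def by blast

lemma schur_multiplier_bound:
  assumes "schur_multiplier E N \<phi> T"
  obtains C where "0 \<le> C"
    "\<And>x. x \<in> schatten l1 \<Longrightarrow> schatten_norm N (T x) \<le> C * schatten_norm l1_norm x"
proof -
  obtain C where C: "\<And>x. x \<in> schatten l1 \<Longrightarrow> schatten_norm N (T x) \<le> C * schatten_norm l1_norm x"
    using assms unfolding schur_multiplier_def bounded_map_def by blast
  have "schatten_norm N (T x) \<le> \<bar>C\<bar> * schatten_norm l1_norm x" if "x \<in> schatten l1" for x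
    using C[OF that] mult_right_mono[OF abs_ge_self[of C] trace_norm_nonneg[OF that]] by linarith
  then show ?thesis
    by (rule that[of "\<bar>C\<bar>", rotated]) auto
qed

lemma schur_multiplier_matrix_unit:
  assumes T: "schur_multiplier E N \<phi> T" and d: "delta 0 \<in> E"
  shows "schatten_norm N (T (rank_one (unit_vec i) (unit_vec j))) = cmod (\<phi> i j) * N (delta 0)"
proof -
  have eq: "T (rank_one (unit_vec i) (unit_vec j)) = rank_one (\<phi> i j *\<^sub>C unit_vec i) (unit_vec j)"
    by (rule B_ell2_eqI)
      (auto simp: schur_multiplier_B_ell2[OF T] schur_multiplier_entry[OF T] rank_one_schatten_l1
        entry_rank_one)
  have "(\<lambda>n. complex_of_real (singular_number (T (rank_one (unit_vec i) (unit_vec j))) n)) =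
      (\<lambda>n. complex_of_real (cmod (\<phi> i j)) * delta 0 n)"
    unfolding eq singular_number_rank_one by (auto simp: norm_rank_one norm_scaleC)
  then show ?thesis
    using norm_scale[OF d, of "complex_of_real (cmod (\<phi> i j))"] by (simp add: schatten_norm_def)
qed

lemma schur_multiplier_diag_bounded:
  assumes T: "schur_multiplier E N \<phi> T" and d: "delta 0 \<in> E"
  shows "\<exists>M. \<forall>i. cmod (\<phi> i i) \<le> M"
proof -
  obtain C where C: "0 \<le> C"
    "\<And>x. x \<in> schatten l1 \<Longrightarrow> schatten_norm N (T x) \<le> C * schatten_norm l1_norm x"
    by (rule schur_multiplier_bound[OF T]) blast
  have "cmod (\<phi> i i) \<le> C / N (delta 0)" for i
  proof -
    have "cmod (\<phi> i i) * N (delta 0) \<le> C * schatten_norm l1_norm (rank_one (unit_vec i) (unit_vec i))"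
      unfolding schur_multiplier_matrix_unit[OF T d, symmetric] by (intro C rank_one_schatten_l1)
    also have "\<dots> \<le> C * 1"
      using trace_norm_rank_one_le[of "unit_vec i" "unit_vec i"] C(1) by (intro mult_left_mono) auto
    finally show ?thesis
      using delta_norm_pos[OF d] by (simp add: pos_le_divide_eq)
  qed
  then show ?thesis
    by blast
qed

lemma dunford_pettis_symbol_tendsto:
  assumes T: "schur_multiplier E N \<phi> T" and d: "delta 0 \<in> E" and dp: "dunford_pettis N T"
  shows "(\<lambda>i. \<phi> i j) \<longlonglongrightarrow> 0"
proof -
  have "(\<lambda>i. cmod (\<phi> i j) * N (delta 0)) \<longlonglongrightarrow> 0"
    using dp matrix_unit_column_weakly_null[of j]
    unfolding dunford_pettis_def schur_multiplier_matrix_unit[OF T d, symmetric] by blast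
  then have "(\<lambda>i. cmod (\<phi> i j) * N (delta 0) / N (delta 0)) \<longlonglongrightarrow> 0 / N (delta 0)"
    using delta_norm_pos[OF d] by (intro tendsto_divide tendsto_const) auto
  then have "(\<lambda>i. cmod (\<phi> i j)) \<longlonglongrightarrow> 0"
    using delta_norm_pos[OF d] by simp
  then show ?thesis
    by (rule tendsto_norm_zero_cancel)
qed

end

lemma norm_proj_finite_le: "norm (proj {..<m} w) \<le> (\<Sum>j<m. cmod (coord w j))"
proof -
  have "norm (proj {..<m} w) \<le> (\<Sum>j<m. norm (coord w j *\<^sub>C unit_vec j))"
    by (simp add: proj_finite norm_sum)
  then show ?thesis
    by (simp add: norm_scaleC)
qed

text \<open>A diagonal operator with entries tending to zero is compact: it maps bounded sequences that
  tend to zero in each coordinate to norm null sequences.\<close>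

lemma c0_multiplier_norm_tendsto:
  fixes w p :: "nat \<Rightarrow> ell2" and d :: "nat \<Rightarrow> complex"
  assumes d: "d \<longlonglongrightarrow> 0" and coord: "\<And>j. (\<lambda>n. coord (p n) j) \<longlonglongrightarrow> 0"
    and bounded: "\<And>n. n \<ge> n0 \<Longrightarrow> norm (p n) \<le> C"
    and w: "\<And>n j. cmod (coord (w n) j) = cmod (d j) * cmod (coord (p n) j)"
  shows "(\<lambda>n. norm (w n)) \<longlonglongrightarrow> 0"
proof (rule LIMSEQ_I)
  fix e :: real assume e: "0 < e"
  define \<eta> where "\<eta> = e / (2 * (\<bar>C\<bar> + 1))"
  have "0 < \<eta>"
    using e by (simp add: \<eta>_def)
  then have "\<forall>\<^sub>F j in sequentially. cmod (d j) < \<eta>"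
    using tendsto_norm_zero[OF d] by (intro order_tendstoD)
  then obtain J where J: "\<And>j. j \<ge> J \<Longrightarrow> cmod (d j) < \<eta>"
    unfolding eventually_sequentially by blast
  have "(\<lambda>n. \<Sum>j<J. cmod (coord (w n) j)) \<longlonglongrightarrow> (\<Sum>j<J. cmod (d j) * 0)"
    unfolding w by (intro tendsto_sum tendsto_mult tendsto_const tendsto_norm_zero coord)
  then have "\<forall>\<^sub>F n in sequentially. (\<Sum>j<J. cmod (coord (w n) j)) < e / 2"
    by (rule order_tendstoD) (use e in simp)
  then obtain n1 where n1: "\<And>n. n \<ge> n1 \<Longrightarrow> (\<Sum>j<J. cmod (coord (w n) j)) < e / 2"
    unfolding eventually_sequentially by blast
  have "norm (w n) < e" if n: "n \<ge> max n0 n1" for n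
  proof -
    have "norm (proj (- {..<J}) (w n)) \<le> norm (complex_of_real \<eta> *\<^sub>C p n)"
    proof (rule norm_le_of_coord)
      fix j
      show "cmod (coord (proj (- {..<J}) (w n)) j) \<le> cmod (coord (complex_of_real \<eta> *\<^sub>C p n) j)"
        using J[of j] \<open>0 < \<eta>\<close> by (auto simp: w norm_mult intro!: mult_right_mono)
    qed
    also have "\<dots> \<le> \<eta> * \<bar>C\<bar>"
      using bounded[of n] n \<open>0 < \<eta>\<close> by (simp add: norm_scaleC)
    also have "\<dots> \<le> e / 2"
      using e by (simp add: \<eta>_def field_simps)
    finally have "norm (proj (- {..<J}) (w n)) \<le> e / 2" .
    moreover have "norm (proj {..<J} (w n)) < e / 2"
      using norm_proj_finite_le[of J "w n"] n1[of n] n by simp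
    moreover have "w n = proj {..<J} (w n) + proj (- {..<J}) (w n)"
      by (rule coord_eqI) auto
    ultimately show ?thesis
      using norm_triangle_ineq[of "proj {..<J} (w n)" "proj (- {..<J}) (w n)"] by simp
  qed
  then show "\<exists>n0. \<forall>n\<ge>n0. norm (norm (w n) - 0) < e"
    by (intro exI[of _ "max n0 n1"]) simp
qed

lemma row_vector:
  assumes x: "x \<in> B_ell2"
  obtains r where "\<And>v. coord (x v) i = cinner v r" "\<And>j. coord r j = cnj (entry x i j)"
    "norm r \<le> norm x"
proof -
  obtain r where r: "\<And>v. coord (x v) i = cinner v r"
  proof (rule riesz[where g = "\<lambda>v. coord (x v) i" and C = "norm x"])
    show "cmod (coord (x v) i) \<le> norm x * norm v" for v
      by (rule order_trans[OF cmod_coord_le norm_blinfun])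
  qed (auto simp: blinfun.add_right B_ell2_scaleC x)
  have "coord r j = cnj (entry x i j)" for j
    using r[of "unit_vec j"] by (simp add: entry_def cinner_unit_vec_left)
  moreover have "norm r \<le> norm x"
  proof (rule norm_le_of_cinner)
    fix w
    have "cmod (cinner r w) = cmod (coord (x w) i)"
      by (subst cinner_commute) (simp add: r)
    also have "\<dots> \<le> norm x * norm w"
      by (rule order_trans[OF cmod_coord_le norm_blinfun])
    finally show "cmod (cinner r w) \<le> norm x * norm w" .
  qed simp
  ultimately show ?thesis
    using r by (intro that)
qed

lemma rank_le_proj: "rank_le m (proj {..<m})"
proof -
  have "proj {..<m} = (\<Sum>i<m. rank_one (unit_vec i) (unit_vec i))"
    by (rule blinfun_eqI) (simp add: proj_finite blinfun.sum_left)
  then show ?thesis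
    using rank_le_sum_rank_one[of "{..<m}" unit_vec unit_vec] by simp
qed

text \<open>If the rows (columns) of the symbol tend to zero, the Schur multiplier followed by restriction to
  finitely many rows (columns) maps weakly null sequences to norm null ones.\<close>

lemma schur_product_rows_tendsto:
  assumes X: "weakly_null X" and y: "\<And>n. y n \<in> B_ell2"
    and entry: "\<And>n i j. entry (y n) i j = \<phi> i j * entry (X n) i j"
    and row: "\<And>i. (\<lambda>j. \<phi> i j) \<longlonglongrightarrow> 0"
  shows "(\<lambda>n. norm (proj {..<a} o\<^sub>L y n)) \<longlonglongrightarrow> 0"
proof -
  have XB: "X n \<in> B_ell2" for n
    using X by (simp add: weakly_null_def schatten_l1_iff)
  have X0: "(\<lambda>n. entry (X n) i j) \<longlonglongrightarrow> 0" for i j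
    using X bounded_functional_cinner unfolding weakly_null_def entry_def by blast
  obtain C n0 where C: "\<And>n. n \<ge> n0 \<Longrightarrow> norm (X n) \<le> C"
    using weakly_null_bounded[OF X] by blast
  have "\<exists>p. (\<forall>j. coord p j = cnj (entry (X n) i j)) \<and> norm p \<le> norm (X n)" for n i
    using row_vector[OF XB] by metis
  then obtain p where p: "\<And>n i j. coord (p n i) j = cnj (entry (X n) i j)"
    "\<And>n i. norm (p n i) \<le> norm (X n)"
    by metis
  have "\<exists>r. (\<forall>v. coord (y n v) i = cinner v r) \<and> (\<forall>j. coord r j = cnj (entry (y n) i j))" for n i
    using row_vector[OF y] by metis
  then obtain r where r: "\<And>n i v. coord (y n v) i = cinner v (r n i)"
    "\<And>n i j. coord (r n i) j = cnj (entry (y n) i j)"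
    by metis
  have "(\<lambda>n. norm (r n i)) \<longlonglongrightarrow> 0" for i
  proof (rule c0_multiplier_norm_tendsto[OF row[of i]])
    show "(\<lambda>n. coord (p n i) j) \<longlonglongrightarrow> 0" for j
      unfolding p using tendsto_cnj[OF X0[of i j]] by simp
    show "norm (p n i) \<le> C" if "n \<ge> n0" for n
      using p(2)[of n i] C[OF that] by linarith
    show "cmod (coord (r n i) j) = cmod (\<phi> i j) * cmod (coord (p n i) j)" for n j
      by (simp add: r p entry norm_mult)
  qed
  then have "(\<lambda>n. \<Sum>i<a. norm (r n i)) \<longlonglongrightarrow> (\<Sum>i<a. 0)"
    by (intro tendsto_sum)
  then have lim: "(\<lambda>n. \<Sum>i<a. norm (r n i)) \<longlonglongrightarrow> 0"
    by simp
  have le: "norm (proj {..<a} o\<^sub>L y n) \<le> (\<Sum>i<a. norm (r n i))" for n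
  proof (rule norm_blinfun_bound)
    fix v
    have "norm ((proj {..<a} o\<^sub>L y n) v) \<le> (\<Sum>i<a. cmod (coord (y n v) i))"
      by (simp add: norm_proj_finite_le)
    also have "\<dots> \<le> (\<Sum>i<a. norm (r n i) * norm v)"
      unfolding r by (intro sum_mono order_trans[OF norm_cinner_le]) (simp add: mult.commute)
    finally show "norm ((proj {..<a} o\<^sub>L y n) v) \<le> (\<Sum>i<a. norm (r n i)) * norm v"
      by (simp add: sum_distrib_right)
  qed (simp add: sum_nonneg)
  show ?thesis
    by (intro Lim_null_comparison[OF always_eventually lim] allI) (simp add: le)
qed

lemma schur_product_columns_tendsto:
  assumes X: "weakly_null X" and y: "\<And>n. y n \<in> B_ell2"
    and entry: "\<And>n i j. entry (y n) i j = \<phi> i j * entry (X n) i j"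
    and column: "\<And>j. (\<lambda>i. \<phi> i j) \<longlonglongrightarrow> 0"
  shows "(\<lambda>n. norm (y n o\<^sub>L proj {..<a})) \<longlonglongrightarrow> 0"
proof -
  have X0: "(\<lambda>n. entry (X n) i j) \<longlonglongrightarrow> 0" for i j
    using X bounded_functional_cinner unfolding weakly_null_def entry_def by blast
  obtain C n0 where C: "\<And>n. n \<ge> n0 \<Longrightarrow> norm (X n) \<le> C"
    using weakly_null_bounded[OF X] by blast
  have coord: "coord (x (unit_vec j)) i = entry x i j" for x :: oper and i j
    by (simp add: entry_def)
  have "(\<lambda>n. norm (y n (unit_vec j))) \<longlonglongrightarrow> 0" for j
  proof (rule c0_multiplier_norm_tendsto[OF column[of j]])
    show "(\<lambda>n. coord (X n (unit_vec j)) i) \<longlonglongrightarrow> 0" for i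
      unfolding coord by (rule X0)
    show "norm (X n (unit_vec j)) \<le> C" if "n \<ge> n0" for n
      using norm_blinfun[of "X n" "unit_vec j"] C[OF that] by simp
    show "cmod (coord (y n (unit_vec j)) i) = cmod (\<phi> i j) * cmod (coord (X n (unit_vec j)) i)" for n i
      unfolding coord by (simp add: entry norm_mult)
  qed
  then have "(\<lambda>n. \<Sum>j<a. norm (y n (unit_vec j))) \<longlonglongrightarrow> (\<Sum>j<a. 0)"
    by (intro tendsto_sum)
  then have lim: "(\<lambda>n. \<Sum>j<a. norm (y n (unit_vec j))) \<longlonglongrightarrow> 0"
    by simp
  have le: "norm (y n o\<^sub>L proj {..<a}) \<le> (\<Sum>j<a. norm (y n (unit_vec j)))" for n
  proof (rule norm_blinfun_bound)
    fix v
    have "(y n o\<^sub>L proj {..<a}) v = (\<Sum>j<a. coord v j *\<^sub>C y n (unit_vec j))"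
      by (simp add: proj_finite blinfun.sum_right B_ell2_scaleC[OF y])
    also have "norm \<dots> \<le> (\<Sum>j<a. norm v * norm (y n (unit_vec j)))"
      by (intro order_trans[OF norm_sum] sum_mono)
        (auto simp: norm_scaleC intro!: mult_right_mono cmod_coord_le)
    finally show "norm ((y n o\<^sub>L proj {..<a}) v) \<le> (\<Sum>j<a. norm (y n (unit_vec j))) * norm v"
      by (simp add: sum_distrib_left mult.commute[of _ "norm v"])
  qed (simp add: sum_nonneg)
  show ?thesis
    by (intro Lim_null_comparison[OF always_eventually lim] allI) (simp add: le)
qed

proposition (in symmetric_sequence_space) dunford_pettis_of_symbol_tendsto:
  assumes T: "schur_multiplier E N \<phi> T" and d: "delta 0 \<in> E"
    and row: "\<And>i. (\<lambda>j. \<phi> i j) \<longlonglongrightarrow> 0" and column: "\<And>j. (\<lambda>i. \<phi> i j) \<longlonglongrightarrow> 0"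
  shows "dunford_pettis N T"
  unfolding dunford_pettis_def
proof (intro allI impI)
  fix X assume X: "weakly_null X"
  have XS: "X n \<in> schatten l1" for n
    using X by (simp add: weakly_null_def)
  obtain C where C: "0 \<le> C"
    "\<And>x. x \<in> schatten l1 \<Longrightarrow> schatten_norm N (T x) \<le> C * schatten_norm l1_norm x"
    by (rule schur_multiplier_bound[OF T]) blast
  have TE: "T x \<in> schatten E" if "x \<in> schatten l1" for x
    using T that unfolding schur_multiplier_def bounded_map_def by blast
  have TB: "T (X n) \<in> B_ell2" for n
    by (rule schur_multiplier_B_ell2[OF T XS])
  have Tentry: "entry (T (X n)) i j = \<phi> i j * entry (X n) i j" for n i j
    by (rule schur_multiplier_entry[OF T XS])
  show "(\<lambda>n. schatten_norm N (T (X n))) \<longlonglongrightarrow> 0"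
  proof (rule LIMSEQ_I)
    fix e :: real assume e: "0 < e"
    have "0 < e / (4 * (C + 1))"
      using e C(1) by simp
    then obtain a n0 where corner: "\<And>n. n \<ge> n0 \<Longrightarrow>
        schatten_norm l1_norm (proj {a..} o\<^sub>L X n o\<^sub>L proj {a..}) \<le> e / (4 * (C + 1))"
      using weakly_null_corners_small[OF X] by meson
    let ?P = "proj {a..}" and ?Q = "proj {..<a}"
    \<comment> \<open>The image of \<open>X n\<close> without its corner has rank at most \<open>2 * a\<close>, so that its norm is controlled by
      its operator norm.\<close>
    define R where "R n = (?Q o\<^sub>L T (X n)) + (?P o\<^sub>L (T (X n) o\<^sub>L ?Q))" for n
    define K where "K = N (\<lambda>n. if n < a + a then 1 else 0)"
    have K: "0 \<le> K"
      unfolding K_def by (intro norm_nonneg initial_segment_mem d)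
    have RB: "R n \<in> B_ell2" for n
      unfolding R_def using TB by (intro B_ell2_add B_ell2_compose) auto
    have rank: "rank_le (a + a) (R n)" for n
      unfolding R_def
      by (intro rank_le_add rank_le_compose_right rank_le_compose_left rank_le_proj proj_in_B_ell2 TB)
    have "(\<lambda>n. norm (?Q o\<^sub>L T (X n)) + norm (T (X n) o\<^sub>L ?Q)) \<longlonglongrightarrow> 0 + 0"
      by (intro tendsto_add schur_product_rows_tendsto[OF X TB Tentry row]
          schur_product_columns_tendsto[OF X TB Tentry column])
    then have lim: "(\<lambda>n. norm (?Q o\<^sub>L T (X n)) + norm (T (X n) o\<^sub>L ?Q)) \<longlonglongrightarrow> 0"
      by simp
    have le: "norm (R n) \<le> norm (?Q o\<^sub>L T (X n)) + norm (T (X n) o\<^sub>L ?Q)" for n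
    proof -
      have "norm (?P o\<^sub>L (T (X n) o\<^sub>L ?Q)) \<le> norm ?P * norm (T (X n) o\<^sub>L ?Q)"
        by (rule norm_blinfun_compose)
      also have "\<dots> \<le> 1 * norm (T (X n) o\<^sub>L ?Q)"
        by (intro mult_right_mono norm_proj_le norm_ge_zero)
      finally show ?thesis
        unfolding R_def using norm_triangle_ineq[of "?Q o\<^sub>L T (X n)" "?P o\<^sub>L (T (X n) o\<^sub>L ?Q)"] by simp
    qed
    have "(\<lambda>n. norm (R n)) \<longlonglongrightarrow> 0"
      by (intro Lim_null_comparison[OF always_eventually lim] allI) (simp add: le)
    then have "(\<lambda>n. norm (R n) * K) \<longlonglongrightarrow> 0 * K"
      by (intro tendsto_mult tendsto_const)
    then have "\<forall>\<^sub>F n in sequentially. norm (R n) * K < e / 2"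
      by (rule order_tendstoD) (use e in simp)
    then obtain n1 where n1: "\<And>n. n \<ge> n1 \<Longrightarrow> norm (R n) * K < e / 2"
      unfolding eventually_sequentially by blast
    have "schatten_norm N (T (X n)) < e" if n: "n \<ge> max n0 n1" for n
    proof -
      define Z where "Z = ?P o\<^sub>L X n o\<^sub>L ?P"
      have Z: "Z \<in> schatten l1"
        unfolding Z_def using XS by (intro compose_contractions_schatten_l1 norm_proj_le) auto
      have XB: "X n \<in> B_ell2"
        using XS by (simp add: schatten_l1_iff)
      have TZ: "T Z = ?P o\<^sub>L T (X n) o\<^sub>L ?P"
      proof (rule B_ell2_eqI)
        show "entry (T Z) i j = entry (?P o\<^sub>L T (X n) o\<^sub>L ?P) i j" for i j
          by (simp add: schur_multiplier_entry[OF T Z] entry_proj[OF TB] Tentry)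
            (simp add: Z_def entry_proj[OF XB])
      qed (use TB in \<open>auto intro!: schur_multiplier_B_ell2[OF T Z] B_ell2_compose\<close>)
      have decomp: "T (X n) = T Z + R n"
      proof (rule blinfun_eqI)
        have P: "?P v = v - ?Q v" for v
          using proj_compl[of "{..<a}" v] by (simp add: Compl_lessThan)
        fix v
        show "T (X n) v = (T Z + R n) v"
          by (simp add: TZ R_def P blinfun.add_left blinfun.diff_right)
      qed
      have "schatten_norm N (T Z) \<le> C * (e / (4 * (C + 1)))"
        using C(2)[OF Z] mult_left_mono[OF corner[of n] C(1)] n by (simp add: Z_def)
      also have "\<dots> \<le> e / 4"
        using C(1) e by (simp add: field_simps)
      finally have "schatten_norm N (T Z) \<le> e / 4" .
      moreover have "schatten_norm N (T (X n)) \<le> 2 * schatten_norm N (T Z) + norm (R n) * K"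
        unfolding K_def by (subst decomp) (rule schatten_norm_perturb[OF TE[OF Z] d RB rank])
      ultimately show ?thesis
        using n1[of n] n by simp
    qed
    moreover have "0 \<le> schatten_norm N (T (X n))" for n
      using TE[OF XS[of n]] norm_nonneg by (simp add: schatten_norm_def schatten_def)
    ultimately show "\<exists>n0. \<forall>n\<ge>n0. norm (schatten_norm N (T (X n)) - 0) < e"
      by (intro exI[of _ "max n0 n1"]) simp
  qed
qed

theorem theorem2p4p1:
  fixes E :: "(nat \<Rightarrow> complex) set" and N :: "(nat \<Rightarrow> complex) \<Rightarrow> real"
    and \<phi> \<psi> :: "nat \<Rightarrow> nat \<Rightarrow> complex" and S\<^sub>\<phi> S\<^sub>\<psi> :: "oper \<Rightarrow> oper"
  assumes "symmetric_sequence_space E N"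
    and "schur_multiplier E N \<phi> S\<^sub>\<phi>" and "schur_multiplier E N \<psi> S\<^sub>\<psi>"
    and "pos_map S\<^sub>\<phi>" and "oper_map_le S\<^sub>\<phi> S\<^sub>\<psi>"
    and "dunford_pettis N S\<^sub>\<psi>"
  shows "dunford_pettis N S\<^sub>\<phi>"
proof -
  interpret symmetric_sequence_space E N
    by fact
  note S = assms(2,3)
  show ?thesis
  proof (cases "delta 0 \<in> E")
    case True
    have \<phi>: "psd_kernel \<phi>"
      using assms(4) schur_multiplier_entry[OF S(1)] by (rule psd_kernel_of_pos_map)
    have diff: "psd_kernel (\<lambda>i j. \<psi> i j - \<phi> i j)"
    proof (rule psd_kernel_of_pos_map)
      show "pos_map (\<lambda>x. S\<^sub>\<psi> x - S\<^sub>\<phi> x)"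
        using assms(5) by (simp add: oper_map_le_def)
      fix x i j assume x: "x \<in> schatten l1"
      have "entry (S\<^sub>\<psi> x - S\<^sub>\<phi> x) i j = entry (S\<^sub>\<psi> x) i j - entry (S\<^sub>\<phi> x) i j"
        by (simp add: entry_def blinfun.diff_left)
      then show "entry (S\<^sub>\<psi> x - S\<^sub>\<phi> x) i j = (\<psi> i j - \<phi> i j) * entry x i j"
        by (simp add: schur_multiplier_entry[OF S(1) x] schur_multiplier_entry[OF S(2) x]
            left_diff_distrib)
    qed
    have herm: "\<psi> j i = cnj (\<psi> i j)" for i j
      using psd_kernel_hermitian[OF \<phi>, of j i] psd_kernel_hermitian[OF diff, of j i] by simp
    obtain M where "\<And>i. cmod (\<psi> i i) \<le> M"
      using schur_multiplier_diag_bounded[OF S(2) True] by blast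
    then have column: "(\<lambda>i. \<phi> i j) \<longlonglongrightarrow> 0" for j
      by (rule psd_kernel_dominated_tendsto[OF \<phi> diff herm])
        (rule dunford_pettis_symbol_tendsto[OF S(2) True assms(6)])
    have "(\<lambda>j. \<phi> i j) \<longlonglongrightarrow> 0" for i
      using tendsto_cnj[OF column[of i]] psd_kernel_hermitian[OF \<phi>, of i] by simp
    then show ?thesis
      using column by (rule dunford_pettis_of_symbol_tendsto[OF S(1) True])
  next
    \<comment> \<open>In this case \<open>E\<close> contains only the zero sequence.\<close>
    case False
    have zero: "s = (\<lambda>_. 0)" if "s \<in> E" for s
      using delta_mem[OF that] False by blast
    have "schatten_norm N (S\<^sub>\<phi> x) = 0" if "x \<in> schatten l1" for x
    proof -
      have "(\<lambda>n. complex_of_real (singular_number (S\<^sub>\<phi> x) n)) \<in> E"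
        using S(1) that unfolding schur_multiplier_def bounded_map_def schatten_def by blast
      then show ?thesis
        unfolding schatten_norm_def using zero norm_eq_zero zero_mem by metis
    qed
    then show ?thesis
      by (simp add: dunford_pettis_def weakly_null_def)
  qed
qed

end
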